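(* Let $\Omega\subset\mathbb{H}$ be a symmetric slice domain, let $f,h\in\mathcal{S}(\Omega)\setminus\{0\}$ and let $I_{0}, M_{0}\in\mathbb{S}$. Then $$f*h\in\mathcal{S}_{I_{0}}(\Omega)\setminus\mathcal{S}_{\mathbb{R}}(\Omega)\quad\text{and}\quad h*f\in\mathcal{S}_{M_{0}}(\Omega)\setminus\mathcal{S}_{\mathbb{R}}(\Omega)$$ if and only if (i) in the case $\mathbb{C}_{I_{0}}=\mathbb{C}_{M_{0}}$: either $f,h\in\mathcal{S}_{I_{0}}(\Omega)$, or there exist $J_{0},K_{0}\in\mathbb{S}$ both orthogonal to $I_{0}$ and $\tilde f, \tilde h\in\mathcal{S}_{I_{0}}(\Omega)\setminus\{0\}$ such that $$f=\tilde f*K_{0},\qquad h=J_{0}*\tilde h;$$ (ii) in the case $\mathbb{C}_{I_{0}}\neq\mathbb{C}_{M_{0}}$: with $K_0=\frac{I_0\wedge M_0}{|I_0\wedge M_0|}$, $J_0=K_0I_0$ and $M_0=aI_0+bJ_0$ (where $b>0$, $a^2+b^2=1$), there exist $\tilde f, \tilde h\in\mathcal{S}_{I_{0}}(\Omega)\setminus\{0\}$ such that, for one of the two choices of the sign (the same in both formulas), $$f=\tilde f*\left(1+\frac{a \pm1}{ b }K_0\right),\qquad h=\left(1-\frac{a \pm1}{ b }K_0\right)*\tilde h.$$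
   Context: $\mathbb{H}$ is the algebra of quaternions with standard basis $1,i,j,k$, $\mathrm{Im}\,\mathbb{H}=\mathrm{Span}_{\mathbb{R}}(i,j,k)\simeq\mathbb{R}^3$ (Euclidean, with cross product $\wedge$), $\mathbb{S}=\{q\in\mathbb{H}: q^2=-1\}\subset\mathrm{Im}\,\mathbb{H}$, and $\mathbb{C}_I=\mathrm{Span}_{\mathbb{R}}(1,I)$ for $I\in\mathbb{S}$. A symmetric slice domain $\Omega\subset\mathbb{H}$ is a domain (connected open set) such that $\Omega\cap\mathbb{R}\neq\emptyset$ and, whenever $\alpha+I\beta\in\Omega$ ($\alpha,\beta\in\mathbb{R}$, $I\in\mathbb{S}$), also $\alpha+J\beta\in\Omega$ for all $J\in\mathbb{S}$. A function $f:\Omega\to\mathbb{H}$ is slice regular if for every $J\in\mathbb{S}$ the restriction $f_J$ of $f$ to $\Omega\cap\mathbb{C}_J$ is holomorphic: $\frac12\left(\frac{\partial}{\partial\alpha}+J\frac{\partial}{\partial\beta}\right)f_J(\alpha+J\beta)\equiv0$. $\mathcal{S}(\Omega)$ is the set of slice regular functions on $\Omega$; $\mathcal{S}_{\mathbb{R}}(\Omega)$ is the subset of slice preserving functions, i.e. $f(\Omega\cap\mathbb{C}_I)\subset\mathbb{C}_I$ for all $I\in\mathbb{S}$; $\mathcal{S}_{J}(\Omega)$ is the set of $f\in\mathcal{S}(\Omega)$ with $f(\Omega\cap\mathbb{C}_J)\subset\mathbb{C}_J$. Known fact: every $f\in\mathcal{S}(\Omega)$ is written uniquely as $f=f_0+f_1i+f_2j+f_3k$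 with $f_0,\dots,f_3\in\mathcal{S}_{\mathbb{R}}(\Omega)$. The $*$-product is $f*g=f_0g_0-f_1g_1-f_2g_2-f_3g_3+f_0(g_1i+g_2j+g_3k)+g_0(f_1i+f_2j+f_3k)+(f_2g_3-f_3g_2)i+(f_3g_1-f_1g_3)j+(f_1g_2-f_2g_1)k$ (pointwise products); it is associative. Quaternions are regarded as constant slice regular functions.
   Formalization: The "if" direction fails when f*h is slice preserving (e.g. f=h=1), so (i)/(ii) are shown equivalent to the left side only together with f*h not in S_R(Ω); (i)/(ii) alone are shown to give f*h in S_{I0}(Ω) and h*f in S_{M0}(Ω). *)

theory Defs
  imports "HOL-Analysis.Analysis"
begin

section \<open>The real normed division algebra of quaternions\<close>

datatype quat = Quat (qRe: real) (qIm1: real) (qIm2: real) (qIm3: real)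

lemma quat_eq_iff:
  "p = q \<longleftrightarrow> qRe p = qRe q \<and> qIm1 p = qIm1 q \<and> qIm2 p = qIm2 q \<and> qIm3 p = qIm3 q"
  by (cases p; cases q) simp

instantiation quat :: ring_1
begin

definition zero_quat where "0 = Quat 0 0 0 0"
definition one_quat where "1 = Quat 1 0 0 0"
definition plus_quat where
  "p + q = Quat (qRe p + qRe q) (qIm1 p + qIm1 q) (qIm2 p + qIm2 q) (qIm3 p + qIm3 q)"
definition uminus_quat where
  "- p = Quat (- qRe p) (- qIm1 p) (- qIm2 p) (- qIm3 p)"
definition minus_quat where
  "p - q = Quat (qRe p - qRe q) (qIm1 p - qIm1 q) (qIm2 p - qIm2 q) (qIm3 p - qIm3 q)"
definition times_quat where
  "p * q = Quat
     (qRe p * qRe q - qIm1 p * qIm1 q - qIm2 p * qIm2 q - qIm3 p * qIm3 q)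
     (qRe p * qIm1 q + qIm1 p * qRe q + qIm2 p * qIm3 q - qIm3 p * qIm2 q)
     (qRe p * qIm2 q - qIm1 p * qIm3 q + qIm2 p * qRe q + qIm3 p * qIm1 q)
     (qRe p * qIm3 q + qIm1 p * qIm2 q - qIm2 p * qIm1 q + qIm3 p * qRe q)"

instance
  by standard
    (simp_all add: quat_eq_iff zero_quat_def one_quat_def plus_quat_def uminus_quat_def
      minus_quat_def times_quat_def algebra_simps)

end

instantiation quat :: real_algebra_1
begin

definition scaleR_quat where
  "r *\<^sub>R q = Quat (r * qRe q) (r * qIm1 q) (r * qIm2 q) (r * qIm3 q)"

instance
  by standard
    (simp_all add: quat_eq_iff plus_quat_def times_quat_def scaleR_quat_def algebra_simps)

end

instantiation quat :: real_inner
begin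

definition inner_quat where
  "p \<bullet> q = qRe p * qRe q + qIm1 p * qIm1 q + qIm2 p * qIm2 q + qIm3 p * qIm3 q"
definition norm_quat where "norm (q::quat) = sqrt (q \<bullet> q)"
definition sgn_quat where "sgn (q::quat) = q /\<^sub>R norm q"
definition dist_quat where "dist (p::quat) q = norm (p - q)"
definition uniformity_quat where
  "(uniformity :: (quat \<times> quat) filter) = (INF e\<in>{0 <..}. principal {(x, y). dist x y < e})"
definition open_quat where
  "open (U :: quat set) \<longleftrightarrow> (\<forall>x\<in>U. eventually (\<lambda>(x', y). x' = x \<longrightarrow> y \<in> U) uniformity)"

instance
proof
  fix p q s :: quat and r :: real and U :: "quat set"
  show "dist p q = norm (p - q)" by (rule dist_quat_def)
  show "sgn p = p /\<^sub>R norm p" by (rule sgn_quat_def)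
  show "(uniformity :: (quat \<times> quat) filter) = (INF e\<in>{0 <..}. principal {(x, y). dist x y < e})"
    by (rule uniformity_quat_def)
  show "open U \<longleftrightarrow> (\<forall>x\<in>U. eventually (\<lambda>(x', y). x' = x \<longrightarrow> y \<in> U) uniformity)"
    by (rule open_quat_def)
  show "norm p = sqrt (p \<bullet> p)" by (rule norm_quat_def)
  show "p \<bullet> q = q \<bullet> p" by (simp add: inner_quat_def mult.commute)
  show "(p + q) \<bullet> s = p \<bullet> s + q \<bullet> s"
    by (simp add: inner_quat_def plus_quat_def algebra_simps)
  show "(r *\<^sub>R p) \<bullet> q = r * (p \<bullet> q)"
    by (simp add: inner_quat_def scaleR_quat_def algebra_simps)
  show "0 \<le> p \<bullet> p" by (simp add: inner_quat_def)
  show "p \<bullet> p = 0 \<longleftrightarrow> p = 0"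
    by (simp add: inner_quat_def quat_eq_iff zero_quat_def add_nonneg_eq_0_iff)
qed

end

lemma inner_quat_mult_self: "(p * q) \<bullet> (p * q) = (p \<bullet> p) * (q \<bullet> q)" for p q :: quat
  by (simp add: inner_quat_def times_quat_def algebra_simps)

instantiation quat :: real_normed_div_algebra
begin

definition inverse_quat where
  "inverse q = Quat (qRe q) (- qIm1 q) (- qIm2 q) (- qIm3 q) /\<^sub>R (q \<bullet> q)"
definition divide_quat where "(p::quat) div q = p * inverse q"

instance
proof
  fix p q :: quat
  show "norm (p * q) = norm p * norm q"
    by (simp add: norm_quat_def inner_quat_mult_self real_sqrt_mult)
  show "p div q = p * inverse q" by (rule divide_quat_def)
  show "inverse (0::quat) = 0"
    by (simp add: inverse_quat_def scaleR_quat_def zero_quat_def)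
  assume "p \<noteq> 0"
  then have "p \<bullet> p \<noteq> 0" by simp
  moreover have "p * Quat (qRe p) (- qIm1 p) (- qIm2 p) (- qIm3 p) = (p \<bullet> p) *\<^sub>R 1"
    and "Quat (qRe p) (- qIm1 p) (- qIm2 p) (- qIm3 p) * p = (p \<bullet> p) *\<^sub>R 1"
    by (simp_all add: quat_eq_iff times_quat_def one_quat_def scaleR_quat_def inner_quat_def)
  ultimately show "inverse p * p = 1" and "p * inverse p = 1"
    by (simp_all add: inverse_quat_def)
qed

end

definition quat_i :: quat where "quat_i = Quat 0 1 0 0"
definition quat_j :: quat where "quat_j = Quat 0 0 1 0"
definition quat_k :: quat where "quat_k = Quat 0 0 0 1"

lemma quat_basis_mult:
  "quat_i * quat_i = -1" "quat_j * quat_j = -1" "quat_k * quat_k = -1"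
  "quat_i * quat_j = quat_k" "quat_j * quat_k = quat_i" "quat_k * quat_i = quat_j"
  by (simp_all add: quat_eq_iff quat_i_def quat_j_def quat_k_def times_quat_def
      uminus_quat_def one_quat_def)

definition im_vec :: "quat \<Rightarrow> real ^ 3" where
  "im_vec q = vector [qIm1 q, qIm2 q, qIm3 q]"

definition quat_of_vec :: "real ^ 3 \<Rightarrow> quat" where
  "quat_of_vec v = Quat 0 (v $ 1) (v $ 2) (v $ 3)"

definition wedge :: "quat \<Rightarrow> quat \<Rightarrow> quat" where
  "wedge p q = quat_of_vec (cross3 (im_vec p) (im_vec q))"

definition imag_units :: "quat set" where
  "imag_units = {q. q\<^sup>2 = -1}"

definition slice :: "quat \<Rightarrow> quat set" where
  "slice I = span {1, I}"


section \<open>Slice regular functions\<close>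

definition symmetric_slice_domain :: "quat set \<Rightarrow> bool" where
  "symmetric_slice_domain \<Omega> \<longleftrightarrow>
     open \<Omega> \<and> connected \<Omega> \<and> \<Omega> \<inter> \<real> \<noteq> {} \<and>
     (\<forall>\<alpha> \<beta>. \<forall>I\<in>imag_units. \<forall>J\<in>imag_units.
        of_real \<alpha> + \<beta> *\<^sub>R I \<in> \<Omega> \<longrightarrow> of_real \<alpha> + \<beta> *\<^sub>R J \<in> \<Omega>)"

text \<open>
  Functions on \<open>\<Omega>\<close> are represented by total functions on the quaternions whose values outside
  \<open>\<Omega>\<close> are irrelevant: each of the following sets is closed under changing a function
  outside \<open>\<Omega>\<close>, and equality of functions on \<open>\<Omega>\<close> is written \<open>eq_on \<Omega>\<close>.
\<close>

definition eq_on :: "quat set \<Rightarrow> (quat \<Rightarrow> quat) \<Rightarrow> (quat \<Rightarrow> quat) \<Rightarrow> bool" where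
  "eq_on \<Omega> f g \<longleftrightarrow> (\<forall>x\<in>\<Omega>. f x = g x)"

definition zero_on :: "quat set \<Rightarrow> (quat \<Rightarrow> quat) set" where
  "zero_on \<Omega> = {f. eq_on \<Omega> f (\<lambda>_. 0)}"

text \<open>
  Holomorphy of the restriction to a slice: real differentiability in \<open>(\<alpha>, \<beta>)\<close> together with the
  Cauchy-Riemann equation, where \<open>D (1, 0)\<close> and \<open>D (0, 1)\<close> are the partial derivatives with
  respect to \<open>\<alpha>\<close> and \<open>\<beta>\<close>.
\<close>

definition slice_regular :: "quat set \<Rightarrow> (quat \<Rightarrow> quat) set" where
  "slice_regular \<Omega> = {f. \<forall>J\<in>imag_units. \<forall>\<alpha> \<beta>. of_real \<alpha> + \<beta> *\<^sub>R J \<in> \<Omega> \<longrightarrow>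
     (\<exists>D. ((\<lambda>(s, t). f (of_real s + t *\<^sub>R J)) has_derivative D) (at (\<alpha>, \<beta>)) \<and>
          (1/2) *\<^sub>R (D (1, 0) + J * D (0, 1)) = 0)}"

definition slice_preserving :: "quat set \<Rightarrow> (quat \<Rightarrow> quat) set" where
  "slice_preserving \<Omega> =
     {f \<in> slice_regular \<Omega>. \<forall>I\<in>imag_units. f ` (\<Omega> \<inter> slice I) \<subseteq> slice I}"

definition one_slice_preserving :: "quat set \<Rightarrow> quat \<Rightarrow> (quat \<Rightarrow> quat) set" where
  "one_slice_preserving \<Omega> J = {f \<in> slice_regular \<Omega>. f ` (\<Omega> \<inter> slice J) \<subseteq> slice J}"

definition slice_decomposition ::
    "quat set \<Rightarrow> (quat \<Rightarrow> quat) \<Rightarrow> (nat \<Rightarrow> quat \<Rightarrow> quat) \<Rightarrow> bool" where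
  "slice_decomposition \<Omega> f F \<longleftrightarrow>
     (\<forall>n\<in>{0, 1, 2, 3}. F n \<in> slice_preserving \<Omega>) \<and>
     eq_on \<Omega> f (\<lambda>x. F 0 x + F 1 x * quat_i + F 2 x * quat_j + F 3 x * quat_k)"

text \<open>
  For slice regular \<open>f\<close> on a symmetric slice domain the components \<open>F 0, \<dots>, F 3\<close> exist and are
  unique on \<open>\<Omega>\<close>. They are not unique outside \<open>\<Omega>\<close>, hence the choice operator; the values on \<open>\<Omega>\<close>
  of the \<open>*\<close>-product below do not depend on the choice.
\<close>

definition slice_components :: "quat set \<Rightarrow> (quat \<Rightarrow> quat) \<Rightarrow> nat \<Rightarrow> quat \<Rightarrow> quat" where
  "slice_components \<Omega> f = (SOME F. slice_decomposition \<Omega> f F)"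

definition star :: "quat set \<Rightarrow> (quat \<Rightarrow> quat) \<Rightarrow> (quat \<Rightarrow> quat) \<Rightarrow> quat \<Rightarrow> quat" where
  "star \<Omega> f g = (\<lambda>x.
     let f0 = slice_components \<Omega> f 0 x; f1 = slice_components \<Omega> f 1 x;
         f2 = slice_components \<Omega> f 2 x; f3 = slice_components \<Omega> f 3 x;
         g0 = slice_components \<Omega> g 0 x; g1 = slice_components \<Omega> g 1 x;
         g2 = slice_components \<Omega> g 2 x; g3 = slice_components \<Omega> g 3 x
     in f0 * g0 - f1 * g1 - f2 * g2 - f3 * g3
        + f0 * (g1 * quat_i + g2 * quat_j + g3 * quat_k)
        + g0 * (f1 * quat_i + f2 * quat_j + f3 * quat_k)
        + (f2 * g3 - f3 * g2) * quat_i
        + (f3 * g1 - f1 * g3) * quat_j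
        + (f1 * g2 - f2 * g1) * quat_k)"

end

theory Submission
  imports Defs "HOL-Complex_Analysis.Complex_Analysis"
begin

text \<open>
  A slice regular function is induced by a holomorphic stem function with values in the complexified
  quaternions, and the \<open>*\<close>-product becomes the pointwise product of stems. A function preserves the
  slice of \<open>I\<close> iff its stem commutes with \<open>I\<close>. If \<open>f * h = p + q I\<close> and \<open>h * f = p' + q' M\<close>, then real
  parts and norms of the two products agree, so \<open>p' = p\<close> and \<open>q' = \<epsilon> q\<close> with a constant sign \<open>\<epsilon>\<close>, as
  holomorphic functions on a connected set have no zero divisors. Associativity then yields
  \<open>I f = \<epsilon> f M\<close> and \<open>M h = \<epsilon> h I\<close>. Conversely, these two relations imply that the products preserve
  the slices of \<open>I\<close> and \<open>M\<close>. For any quaternion \<open>v \<noteq> 0\<close> with \<open>I v = \<epsilon> v M\<close>, the relation for \<open>f\<close> says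
  that \<open>f v\<^sup>-\<^sup>1\<close> commutes with \<open>I\<close>, and similarly for \<open>h\<close>; the factors in the theorem are explicit such \<open>v\<close>.
\<close>

section \<open>Complexified quaternions\<close>

text \<open>The tensor product of the quaternions with the complex numbers, in coordinates over
  \<open>1, i, j, k\<close>. The complex unit is central and unrelated to \<open>quat_i\<close>, and
  holomorphy can be asked of each coordinate.\<close>

datatype biquat = Biquat (bq0: complex) (bq1: complex) (bq2: complex) (bq3: complex)

lemma biquat_eq_iff:
  "v = w \<longleftrightarrow> bq0 v = bq0 w \<and> bq1 v = bq1 w \<and> bq2 v = bq2 w \<and> bq3 v = bq3 w"
  by (cases v; cases w) simp

instantiation biquat :: ring_1
begin

definition zero_biquat where "0 = Biquat 0 0 0 0"
definition one_biquat where "1 = Biquat 1 0 0 0"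
definition plus_biquat where
  "v + w = Biquat (bq0 v + bq0 w) (bq1 v + bq1 w) (bq2 v + bq2 w) (bq3 v + bq3 w)"
definition uminus_biquat where
  "- v = Biquat (- bq0 v) (- bq1 v) (- bq2 v) (- bq3 v)"
definition minus_biquat where
  "v - w = Biquat (bq0 v - bq0 w) (bq1 v - bq1 w) (bq2 v - bq2 w) (bq3 v - bq3 w)"
definition times_biquat where
  "v * w = Biquat
     (bq0 v * bq0 w - bq1 v * bq1 w - bq2 v * bq2 w - bq3 v * bq3 w)
     (bq0 v * bq1 w + bq1 v * bq0 w + bq2 v * bq3 w - bq3 v * bq2 w)
     (bq0 v * bq2 w - bq1 v * bq3 w + bq2 v * bq0 w + bq3 v * bq1 w)
     (bq0 v * bq3 w + bq1 v * bq2 w - bq2 v * bq1 w + bq3 v * bq0 w)"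

instance
  by standard
    (simp_all add: biquat_eq_iff zero_biquat_def one_biquat_def plus_biquat_def uminus_biquat_def
      minus_biquat_def times_biquat_def algebra_simps)

end

lemmas biquat_ops =
  zero_biquat_def one_biquat_def plus_biquat_def uminus_biquat_def minus_biquat_def times_biquat_def

lemmas quat_ops =
  zero_quat_def one_quat_def plus_quat_def uminus_quat_def minus_quat_def times_quat_def
  scaleR_quat_def

definition biquat_of_complex :: "complex \<Rightarrow> biquat" where
  "biquat_of_complex c = Biquat c 0 0 0"

definition biquat_of_quat :: "quat \<Rightarrow> biquat" where
  "biquat_of_quat q = Biquat (of_real (qRe q)) (of_real (qIm1 q)) (of_real (qIm2 q)) (of_real (qIm3 q))"

text \<open>Conjugates the complex coefficients only and fixes \<open>i, j, k\<close>; unlike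
  quaternionic conjugation it keeps the order of factors.\<close>

definition biquat_cnj :: "biquat \<Rightarrow> biquat" where
  "biquat_cnj w = Biquat (cnj (bq0 w)) (cnj (bq1 w)) (cnj (bq2 w)) (cnj (bq3 w))"

lemma biquat_of_complex_commute: "biquat_of_complex c * w = w * biquat_of_complex c"
  by (simp add: biquat_eq_iff biquat_of_complex_def biquat_ops mult.commute)

lemma biquat_of_quat_mult: "biquat_of_quat (p * q) = biquat_of_quat p * biquat_of_quat q"
  by (simp add: biquat_eq_iff biquat_of_quat_def quat_ops biquat_ops)

lemma biquat_of_quat_uminus: "biquat_of_quat (- q) = - biquat_of_quat q"
  by (simp add: biquat_eq_iff biquat_of_quat_def quat_ops biquat_ops)

lemma biquat_of_quat_1: "biquat_of_quat 1 = 1"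
  by (simp add: biquat_eq_iff biquat_of_quat_def quat_ops biquat_ops)

lemma biquat_cnj_mult: "biquat_cnj (v * w) = biquat_cnj v * biquat_cnj w"
  by (simp add: biquat_eq_iff biquat_cnj_def biquat_ops)

lemma biquat_cnj_of_quat [simp]: "biquat_cnj (biquat_of_quat q) = biquat_of_quat q"
  by (simp add: biquat_cnj_def biquat_of_quat_def)

lemma biquat_cnj_sel [simp]:
  "bq0 (biquat_cnj w) = cnj (bq0 w)" "bq1 (biquat_cnj w) = cnj (bq1 w)"
  "bq2 (biquat_cnj w) = cnj (bq2 w)" "bq3 (biquat_cnj w) = cnj (bq3 w)"
  by (simp_all add: biquat_cnj_def)


section \<open>Slices\<close>

text \<open>The vector part of \<open>I * I\<close> is twice the real part times the vector part, so
  a nonzero real part would leave a real square equal to -1.\<close>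

lemma imag_units_iff:
  "I \<in> imag_units \<longleftrightarrow> qRe I = 0 \<and> (qIm1 I)\<^sup>2 + (qIm2 I)\<^sup>2 + (qIm3 I)\<^sup>2 = 1"
proof
  assume "I \<in> imag_units"
  then have "I * I = -1"
    by (simp add: imag_units_def power2_eq_square)
  then have e: "qRe I * qRe I - qIm1 I * qIm1 I - qIm2 I * qIm2 I - qIm3 I * qIm3 I = -1"
    "qRe I * qIm1 I = 0" "qRe I * qIm2 I = 0" "qRe I * qIm3 I = 0"
    by (simp_all add: quat_eq_iff quat_ops mult.commute)
  have "qRe I = 0"
  proof (rule ccontr)
    assume "qRe I \<noteq> 0"
    then have "qRe I * qRe I = -1"
      using e by simp
    moreover have "qRe I * qRe I \<ge> 0" by simp
    ultimately show False by linarith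
  qed
  then show "qRe I = 0 \<and> (qIm1 I)\<^sup>2 + (qIm2 I)\<^sup>2 + (qIm3 I)\<^sup>2 = 1"
    using e(1) by (simp add: power2_eq_square)
next
  assume "qRe I = 0 \<and> (qIm1 I)\<^sup>2 + (qIm2 I)\<^sup>2 + (qIm3 I)\<^sup>2 = 1"
  then show "I \<in> imag_units"
    by (simp add: imag_units_def power2_eq_square quat_eq_iff quat_ops)
qed

lemma imag_units_mult_self: "I \<in> imag_units \<Longrightarrow> I * I = -1"
  by (simp add: imag_units_def power2_eq_square)

lemma imag_units_uminus: "I \<in> imag_units \<Longrightarrow> - I \<in> imag_units"
  by (simp add: imag_units_def)

lemma quat_units: "quat_i \<in> imag_units" "quat_j \<in> imag_units" "quat_k \<in> imag_units"
  by (simp_all add: imag_units_iff quat_i_def quat_j_def quat_k_def)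

text \<open>For an imaginary unit \<open>I\<close> this is the isomorphism of real algebras from the
  complex numbers onto \<open>slice I\<close>.\<close>

definition slice_embed :: "quat \<Rightarrow> complex \<Rightarrow> quat" where
  "slice_embed I z = of_real (Re z) + Im z *\<^sub>R I"

lemma bounded_linear_slice_embed: "bounded_linear (slice_embed I)"
proof -
  have "bounded_linear (\<lambda>z. of_real (Re z) + Im z *\<^sub>R I)"
    by (intro bounded_linear_add bounded_linear_compose[OF bounded_linear_of_real bounded_linear_Re]
        bounded_linear_compose[OF bounded_linear_scaleR_left bounded_linear_Im])
  then show ?thesis by (simp add: slice_embed_def[abs_def])
qed

lemma slice_embed_add: "slice_embed I (z + w) = slice_embed I z + slice_embed I w"
  by (simp add: slice_embed_def algebra_simps)

lemma slice_embed_diff: "slice_embed I (z - w) = slice_embed I z - slice_embed I w"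
  by (simp add: slice_embed_def algebra_simps)

lemma slice_embed_mult:
  assumes "I \<in> imag_units"
  shows "slice_embed I (z * w) = slice_embed I z * slice_embed I w"
  using imag_units_mult_self[OF assms]
  by (simp add: slice_embed_def algebra_simps of_real_def)

lemma slice_embed_ii: "slice_embed I \<i> = I"
  by (simp add: slice_embed_def)

lemma slice_embed_0 [simp]: "slice_embed I 0 = 0"
  by (simp add: slice_embed_def)

lemma slice_embed_of_real [simp]: "slice_embed I (of_real r) = of_real r"
  by (simp add: slice_embed_def)

lemma slice_embed_uminus_cnj: "slice_embed (- I) (cnj z) = slice_embed I z"
  by (simp add: slice_embed_def)

lemma slice_eq_range: "slice I = range (slice_embed I)"
proof
  show "slice I \<subseteq> range (slice_embed I)"
    unfolding slice_def
  proof (rule span_minimal)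
    have "1 = slice_embed I 1" "I = slice_embed I \<i>"
      by (simp_all add: slice_embed_def)
    then show "{1, I} \<subseteq> range (slice_embed I)" by blast
    interpret bounded_linear "slice_embed I" by (rule bounded_linear_slice_embed)
    show "subspace (range (slice_embed I))"
      by (intro linear_subspace_image linear_axioms subspace_UNIV)
  qed
  show "range (slice_embed I) \<subseteq> slice I"
  proof
    fix q assume "q \<in> range (slice_embed I)"
    then obtain z where "q = Re z *\<^sub>R 1 + Im z *\<^sub>R I"
      by (auto simp: slice_embed_def of_real_def)
    then show "q \<in> slice I"
      by (simp add: slice_def span_add span_mul span_base)
  qed
qed

lemma subspace_slice: "subspace (slice I)"
  by (simp add: slice_def)

lemma mult_in_slice:
  assumes "I \<in> imag_units" "p \<in> slice I" "q \<in> slice I"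
  shows "p * q \<in> slice I"
  using assms(2,3) unfolding slice_eq_range
  by (auto simp: slice_embed_mult[OF assms(1), symmetric])

text \<open>Commuting with \<open>J\<close> means that the cross product of the vector parts
  vanishes, so the vector part of \<open>q\<close> is parallel to \<open>J\<close>.\<close>

lemma in_slice_iff_commute:
  assumes J: "J \<in> imag_units"
  shows "q \<in> slice J \<longleftrightarrow> J * q = q * J"
proof
  assume "q \<in> slice J"
  then show "J * q = q * J"
    by (auto simp: slice_eq_range slice_embed_def of_real_def algebra_simps)
next
  assume comm: "J * q = q * J"
  \<comment> \<open>The coefficient of \<open>q\<close> along the unit vector
    \<open>J\<close>.\<close>
  let ?d = "qIm1 J * qIm1 q + qIm2 J * qIm2 q + qIm3 J * qIm3 q"
  have unit: "qRe J = 0" "qIm1 J * qIm1 J + qIm2 J * qIm2 J + qIm3 J * qIm3 J = 1"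
    using J by (simp_all add: imag_units_iff power2_eq_square)
  have "qIm2 J * qIm3 q = qIm3 J * qIm2 q" "qIm3 J * qIm1 q = qIm1 J * qIm3 q"
    "qIm1 J * qIm2 q = qIm2 J * qIm1 q"
    using comm unit(1) by (simp_all add: quat_eq_iff times_quat_def algebra_simps)
  then have "qIm1 q = ?d * qIm1 J" "qIm2 q = ?d * qIm2 J" "qIm3 q = ?d * qIm3 J"
    using unit(2) by algebra+
  then have "q = slice_embed J (Complex (qRe q) ?d)"
    using unit(1) by (simp add: slice_embed_def quat_eq_iff of_real_def quat_ops)
  then show "q \<in> slice J"
    by (auto simp: slice_eq_range)
qed

text \<open>Polar coordinates \<open>x = \<alpha> + \<beta> I\<close> with \<open>\<beta> \<ge> 0\<close>; for real \<open>x\<close> the unit \<open>I\<close> is arbitrary.\<close>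

definition slice_coord :: "quat \<Rightarrow> complex" where
  "slice_coord x = Complex (qRe x) (norm (x - of_real (qRe x)))"

definition slice_unit :: "quat \<Rightarrow> quat" where
  "slice_unit x = (if x = of_real (qRe x) then quat_i
     else (x - of_real (qRe x)) /\<^sub>R norm (x - of_real (qRe x)))"

lemma qRe_of_real [simp]: "qRe (of_real r) = r"
  by (simp add: of_real_def quat_ops)

lemma norm_quat_eq: "norm q = sqrt ((qRe q)\<^sup>2 + (qIm1 q)\<^sup>2 + (qIm2 q)\<^sup>2 + (qIm3 q)\<^sup>2)"
  by (simp add: norm_quat_def inner_quat_def power2_eq_square)

lemma norm_imag_units: "I \<in> imag_units \<Longrightarrow> norm I = 1"
  by (simp add: imag_units_iff norm_quat_eq)

lemma slice_unit_in: "slice_unit x \<in> imag_units"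
proof (cases "x = of_real (qRe x)")
  case True
  then show ?thesis by (simp add: slice_unit_def quat_units)
next
  case False
  define y where "y = x - of_real (qRe x)"
  have "y \<noteq> 0" using False by (simp add: y_def)
  moreover have "qRe y = 0" by (simp add: y_def minus_quat_def)
  ultimately have n: "(norm y)\<^sup>2 = (qIm1 y)\<^sup>2 + (qIm2 y)\<^sup>2 + (qIm3 y)\<^sup>2" "norm y \<noteq> 0"
    by (simp_all add: norm_quat_eq[of y] del: norm_eq_zero)
      (auto simp: quat_eq_iff zero_quat_def add_nonneg_eq_0_iff)
  have "slice_unit x = y /\<^sub>R norm y"
    using False by (simp add: slice_unit_def y_def)
  moreover have "y /\<^sub>R norm y \<in> imag_units"
    using n \<open>qRe y = 0\<close>
    by (simp add: imag_units_iff scaleR_quat_def power_mult_distrib flip: distrib_left n(1))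
      (simp flip: power_mult_distrib)
  ultimately show ?thesis by simp
qed

lemma slice_embed_slice_coord: "slice_embed (slice_unit x) (slice_coord x) = x"
  by (simp add: slice_embed_def slice_coord_def slice_unit_def)

lemma qRe_slice_embed: "I \<in> imag_units \<Longrightarrow> qRe (slice_embed I z) = Re z"
  by (simp add: slice_embed_def plus_quat_def scaleR_quat_def imag_units_iff)

lemma slice_coord_slice_embed:
  assumes "I \<in> imag_units"
  shows "slice_coord (slice_embed I z) = Complex (Re z) \<bar>Im z\<bar>"
proof -
  have "slice_embed I z - of_real (Re z) = Im z *\<^sub>R I"
    by (simp add: slice_embed_def)
  then show ?thesis
    by (simp add: slice_coord_def qRe_slice_embed[OF assms] norm_imag_units[OF assms])
qed

text \<open>\<open>slice_coord\<close> lands in the closed upper half plane, so a point with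
  negative imaginary part is seen from the opposite unit.\<close>

lemma slice_unit_slice_embed:
  assumes "I \<in> imag_units" "Im z \<noteq> 0"
  shows "slice_unit (slice_embed I z) = sgn (Im z) *\<^sub>R I"
proof -
  have e: "slice_embed I z - of_real (Re z) = Im z *\<^sub>R I"
    by (simp add: slice_embed_def)
  moreover have "I \<noteq> 0"
    using norm_imag_units[OF assms(1)] by auto
  ultimately have "slice_embed I z \<noteq> of_real (Re z)"
    using assms(2) by (metis eq_iff_diff_eq_0 scaleR_eq_0_iff)
  then show ?thesis
    using assms e
    by (simp add: slice_unit_def qRe_slice_embed norm_imag_units sgn_real_def)
qed

lemma bounded_linear_qsel:
  "bounded_linear qRe" "bounded_linear qIm1" "bounded_linear qIm2" "bounded_linear qIm3"
proof -
  have "qRe = (\<lambda>q. q \<bullet> 1)" "qIm1 = (\<lambda>q. q \<bullet> quat_i)" "qIm2 = (\<lambda>q. q \<bullet> quat_j)"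
    "qIm3 = (\<lambda>q. q \<bullet> quat_k)"
    by (auto simp: inner_quat_def one_quat_def quat_i_def quat_j_def quat_k_def)
  then show "bounded_linear qRe" "bounded_linear qIm1" "bounded_linear qIm2" "bounded_linear qIm3"
    using bounded_linear_inner_left by metis+
qed

lemma continuous_slice_coord: "continuous_on A slice_coord"
proof -
  have "continuous_on A qRe"
    by (rule bounded_linear.continuous_on[OF bounded_linear_qsel(1) continuous_on_id])
  then have "continuous_on A
      (\<lambda>x. complex_of_real (qRe x) + \<i> * complex_of_real (norm (x - of_real (qRe x))))"
    by (intro continuous_intros)
  then show ?thesis
    by (simp add: slice_coord_def[abs_def] complex_eq_iff Complex_eq)
qed

text \<open>The planar shape of \<open>\<Omega>\<close>. By symmetry it is the same for every unit;
  \<open>quat_i\<close> is an arbitrary choice.\<close>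

definition slice_trace :: "quat set \<Rightarrow> complex set" where
  "slice_trace \<Omega> = {z. slice_embed quat_i z \<in> \<Omega>}"

context
  fixes \<Omega> assumes ssd: "symmetric_slice_domain \<Omega>"
begin

lemma slice_trace_iff:
  assumes "I \<in> imag_units"
  shows "z \<in> slice_trace \<Omega> \<longleftrightarrow> slice_embed I z \<in> \<Omega>"
  using ssd assms quat_units(1)
  unfolding symmetric_slice_domain_def slice_trace_def slice_embed_def by blast

lemma cnj_slice_trace: "z \<in> slice_trace \<Omega> \<Longrightarrow> cnj z \<in> slice_trace \<Omega>"
  using slice_trace_iff[OF quat_units(1), of z]
    slice_trace_iff[OF imag_units_uminus[OF quat_units(1)], of "cnj z"]
  by (simp add: slice_embed_uminus_cnj)

lemma slice_coord_in_trace: "x \<in> \<Omega> \<Longrightarrow> slice_coord x \<in> slice_trace \<Omega>"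
  by (simp add: slice_trace_iff[OF slice_unit_in, of _ x] slice_embed_slice_coord)

lemma open_slice_trace: "open (slice_trace \<Omega>)"
proof -
  have "slice_trace \<Omega> = slice_embed quat_i -` \<Omega>"
    by (auto simp: slice_trace_def)
  moreover have "open \<Omega>"
    using ssd by (simp add: symmetric_slice_domain_def)
  ultimately show ?thesis
    by (metis open_vimage bounded_linear.continuous_on[OF bounded_linear_slice_embed continuous_on_id])
qed

lemma real_in_slice_trace: obtains r :: real where "of_real r \<in> slice_trace \<Omega>"
proof -
  obtain x where "x \<in> \<Omega>" "x \<in> \<real>"
    using ssd unfolding symmetric_slice_domain_def by blast
  then obtain r :: real where "of_real r \<in> \<Omega>"
    by (auto elim: Reals_cases)
  then have "complex_of_real r \<in> slice_trace \<Omega>"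
    by (simp add: slice_trace_def)
  then show ?thesis using that by blast
qed

text \<open>The upper half of the trace is the image of \<open>\<Omega>\<close> under \<open>slice_coord\<close>, hence connected, and it
  meets its mirror image in the real points of \<open>\<Omega>\<close>.\<close>

lemma connected_slice_trace: "connected (slice_trace \<Omega>)"
proof -
  let ?U = "slice_coord ` \<Omega>"
  have "connected ?U"
    using ssd unfolding symmetric_slice_domain_def
    by (blast intro: connected_continuous_image continuous_slice_coord)
  moreover from this have "connected (cnj ` ?U)"
    by (intro connected_continuous_image[of ?U cnj] continuous_intros)
  moreover obtain r :: real where r: "of_real r \<in> slice_trace \<Omega>"
    by (rule real_in_slice_trace)
  have up: "z \<in> ?U" if "z \<in> slice_trace \<Omega>" "Im z \<ge> 0" for z
  proof -
    have "slice_coord (slice_embed quat_i z) = z"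
      using that by (simp add: slice_coord_slice_embed[OF quat_units(1)])
    then show ?thesis
      using that by (force simp: slice_trace_def intro: rev_image_eqI)
  qed
  have "?U \<inter> cnj ` ?U \<noteq> {}"
  proof -
    have "of_real r \<in> ?U" using up[OF r] by simp
    moreover from this have "cnj (of_real r) \<in> cnj ` ?U" by (rule imageI)
    ultimately show ?thesis by auto
  qed
  moreover have "slice_trace \<Omega> = ?U \<union> cnj ` ?U"
  proof (intro set_eqI iffI)
    fix z assume z: "z \<in> slice_trace \<Omega>"
    show "z \<in> ?U \<union> cnj ` ?U"
    proof (cases "Im z \<ge> 0")
      case False
      then have "cnj z \<in> ?U" using z by (intro up cnj_slice_trace) auto
      then have "cnj (cnj z) \<in> cnj ` ?U" by (rule imageI)
      then show ?thesis by simp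
    qed (use z up in auto)
  next
    fix z assume "z \<in> ?U \<union> cnj ` ?U"
    then show "z \<in> slice_trace \<Omega>"
      using slice_coord_in_trace cnj_slice_trace by auto
  qed
  ultimately show ?thesis by (simp add: connected_Un)
qed

end


section \<open>Stem functions\<close>

text \<open>Evaluation of a stem value at the unit \<open>I\<close>: if \<open>w = A + \<iota> B\<close> with quaternions \<open>A\<close> and \<open>B\<close>,
  then \<open>stem_eval I w = A + I B\<close>.\<close>

definition stem_eval :: "quat \<Rightarrow> biquat \<Rightarrow> quat" where
  "stem_eval I w = slice_embed I (bq0 w) + slice_embed I (bq1 w) * quat_i
     + slice_embed I (bq2 w) * quat_j + slice_embed I (bq3 w) * quat_k"

definition quat_realpart :: "biquat \<Rightarrow> quat" where
  "quat_realpart w = Quat (Re (bq0 w)) (Re (bq1 w)) (Re (bq2 w)) (Re (bq3 w))"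

definition quat_imagpart :: "biquat \<Rightarrow> quat" where
  "quat_imagpart w = Quat (Im (bq0 w)) (Im (bq1 w)) (Im (bq2 w)) (Im (bq3 w))"

definition biquat_of_parts :: "quat \<Rightarrow> quat \<Rightarrow> biquat" where
  "biquat_of_parts A B = Biquat (Complex (qRe A) (qRe B)) (Complex (qIm1 A) (qIm1 B))
     (Complex (qIm2 A) (qIm2 B)) (Complex (qIm3 A) (qIm3 B))"

lemma biquat_of_parts_parts: "biquat_of_parts (quat_realpart w) (quat_imagpart w) = w"
  by (simp add: biquat_of_parts_def quat_realpart_def quat_imagpart_def biquat_eq_iff)

lemma stem_eval_parts: "stem_eval I w = quat_realpart w + I * quat_imagpart w"
  by (simp add: stem_eval_def quat_realpart_def quat_imagpart_def slice_embed_def of_real_def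
      quat_ops quat_i_def quat_j_def quat_k_def quat_eq_iff)

lemma stem_eval_of_parts: "stem_eval I (biquat_of_parts A B) = A + I * B"
  by (simp add: stem_eval_parts biquat_of_parts_def quat_realpart_def quat_imagpart_def)

lemma parts_cnj:
  "quat_realpart (biquat_cnj w) = quat_realpart w"
  "quat_imagpart (biquat_cnj w) = - quat_imagpart w"
  by (simp_all add: quat_realpart_def quat_imagpart_def uminus_quat_def)

lemma stem_eval_cnj: "stem_eval I (biquat_cnj w) = stem_eval (- I) w"
  by (simp add: stem_eval_parts parts_cnj)

text \<open>Conjugating the stem value turns \<open>A + I B\<close> into \<open>A - I B\<close>;
  half sum and half difference return \<open>A\<close> and \<open>B\<close>.\<close>

lemma parts_eq_stem_eval:
  assumes "I \<in> imag_units"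
  shows "quat_realpart w = (stem_eval I w + stem_eval I (biquat_cnj w)) /\<^sub>R 2"
    and "quat_imagpart w = - (I * (stem_eval I w - stem_eval I (biquat_cnj w))) /\<^sub>R 2"
proof -
  show "quat_realpart w = (stem_eval I w + stem_eval I (biquat_cnj w)) /\<^sub>R 2"
    by (simp add: stem_eval_parts parts_cnj flip: scaleR_2)
  have "I * (stem_eval I w - stem_eval I (biquat_cnj w)) = - (2 *\<^sub>R quat_imagpart w)"
    by (simp add: stem_eval_parts parts_cnj distrib_left imag_units_mult_self[OF assms]
        scaleR_2 flip: mult.assoc)
  then show "quat_imagpart w = - (I * (stem_eval I w - stem_eval I (biquat_cnj w))) /\<^sub>R 2"
    by simp
qed

lemma parts_mult_of_quat:
  "quat_realpart (biquat_of_quat q * w) = q * quat_realpart w"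
  "quat_imagpart (biquat_of_quat q * w) = q * quat_imagpart w"
  "quat_realpart (w * biquat_of_quat q) = quat_realpart w * q"
  "quat_imagpart (w * biquat_of_quat q) = quat_imagpart w * q"
  by (simp_all add: quat_realpart_def quat_imagpart_def biquat_of_quat_def times_biquat_def
      times_quat_def)

text \<open>\<open>slice J\<close> is a real subalgebra containing \<open>J\<close>, so it contains
  \<open>A + J B\<close> and \<open>A - J B\<close> exactly when it contains \<open>A\<close> and
  \<open>B\<close>, that is, when both commute with \<open>J\<close>.\<close>

lemma stem_eval_in_slice_iff:
  assumes J: "J \<in> imag_units"
  shows "stem_eval J w \<in> slice J \<and> stem_eval J (biquat_cnj w) \<in> slice J \<longleftrightarrow>
    biquat_of_quat J * w = w * biquat_of_quat J"
proof -
  have "stem_eval J w \<in> slice J \<and> stem_eval J (biquat_cnj w) \<in> slice J \<longleftrightarrow>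
      quat_realpart w \<in> slice J \<and> quat_imagpart w \<in> slice J"
  proof
    assume *: "stem_eval J w \<in> slice J \<and> stem_eval J (biquat_cnj w) \<in> slice J"
    have "J \<in> slice J" by (simp add: slice_def span_base)
    then have "J * (stem_eval J w - stem_eval J (biquat_cnj w)) \<in> slice J"
      using * by (intro mult_in_slice J subspace_diff subspace_slice) auto
    then show "quat_realpart w \<in> slice J \<and> quat_imagpart w \<in> slice J"
      using * unfolding parts_eq_stem_eval[OF J, of w]
      by (auto intro: subspace_scale subspace_add subspace_neg subspace_slice)
  next
    assume *: "quat_realpart w \<in> slice J \<and> quat_imagpart w \<in> slice J"
    have "J \<in> slice J" by (simp add: slice_def span_base)
    then show "stem_eval J w \<in> slice J \<and> stem_eval J (biquat_cnj w) \<in> slice J"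
      using * unfolding stem_eval_parts parts_cnj
      by (auto intro!: mult_in_slice J subspace_add subspace_neg subspace_diff subspace_slice)
  qed
  also have "\<dots> \<longleftrightarrow> quat_realpart (biquat_of_quat J * w) = quat_realpart (w * biquat_of_quat J) \<and>
      quat_imagpart (biquat_of_quat J * w) = quat_imagpart (w * biquat_of_quat J)"
    by (simp add: in_slice_iff_commute[OF J] parts_mult_of_quat)
  also have "\<dots> \<longleftrightarrow> biquat_of_quat J * w = w * biquat_of_quat J"
    by (metis biquat_of_parts_parts)
  finally show ?thesis .
qed

section \<open>Holomorphic biquaternion-valued functions and stems\<close>

definition biquat_holomorphic :: "(complex \<Rightarrow> biquat) \<Rightarrow> complex set \<Rightarrow> bool" where
  "biquat_holomorphic F D \<longleftrightarrow> (\<lambda>z. bq0 (F z)) holomorphic_on D \<and> (\<lambda>z. bq1 (F z)) holomorphic_on D \<and>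
     (\<lambda>z. bq2 (F z)) holomorphic_on D \<and> (\<lambda>z. bq3 (F z)) holomorphic_on D"

lemma biquat_holomorphic_const: "biquat_holomorphic (\<lambda>_. w) D"
  by (simp add: biquat_holomorphic_def)

lemma biquat_holomorphic_mult:
  assumes "biquat_holomorphic F D" "biquat_holomorphic G D"
  shows "biquat_holomorphic (\<lambda>z. F z * G z) D"
  using assms unfolding biquat_holomorphic_def times_biquat_def biquat.sel
  by (auto intro!: holomorphic_intros)

lemma biquat_holomorphic_diff:
  assumes "biquat_holomorphic F D" "biquat_holomorphic G D"
  shows "biquat_holomorphic (\<lambda>z. F z - G z) D"
  using assms unfolding biquat_holomorphic_def minus_biquat_def biquat.sel
  by (auto intro!: holomorphic_intros)

text \<open>The conjugation clause makes the two descriptions \<open>(I, z)\<close> and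
  \<open>(- I, cnj z)\<close> of a point give the same value.\<close>

definition is_stem :: "quat set \<Rightarrow> (quat \<Rightarrow> quat) \<Rightarrow> (complex \<Rightarrow> biquat) \<Rightarrow> bool" where
  "is_stem \<Omega> f F \<longleftrightarrow> biquat_holomorphic F (slice_trace \<Omega>) \<and>
     (\<forall>z\<in>slice_trace \<Omega>. F (cnj z) = biquat_cnj (F z)) \<and>
     (\<forall>I\<in>imag_units. \<forall>z\<in>slice_trace \<Omega>. f (slice_embed I z) = stem_eval I (F z))"

definition stem_function :: "(complex \<Rightarrow> biquat) \<Rightarrow> quat \<Rightarrow> quat" where
  "stem_function F x = stem_eval (slice_unit x) (F (slice_coord x))"

text \<open>Where \<open>g\<close> is nonzero, \<open>f\<close> vanishes. If this open set is
  nonempty, the identity theorem makes \<open>f\<close> vanish on the connected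
  \<open>D\<close>.\<close>

lemma holomorphic_mult_eq_0:
  assumes "open D" "connected D" "f holomorphic_on D" "g holomorphic_on D"
    and "\<And>z. z \<in> D \<Longrightarrow> f z * g z = 0"
  shows "(\<forall>z\<in>D. f z = 0) \<or> (\<forall>z\<in>D. g z = 0)"
proof (rule disjCI)
  assume "\<not> (\<forall>z\<in>D. g z = 0)"
  then obtain w where w: "w \<in> D" "g w \<noteq> 0" by blast
  have cont: "continuous_on D g"
    using assms(4) by (rule holomorphic_on_imp_continuous_on)
  let ?U = "D \<inter> g -` (- {0})"
  have "open ?U"
    using continuous_open_preimage[OF cont assms(1), of "- {0}"] by auto
  moreover have "?U \<noteq> {}" using w by auto
  moreover have "f z = 0" if "z \<in> ?U" for z
    using assms(5)[of z] that by auto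
  ultimately show "\<forall>z\<in>D. f z = 0"
    using analytic_continuation_open[of ?U D f "\<lambda>_. 0"] assms by auto
qed

text \<open>The conditions on \<open>DA\<close> and \<open>DB\<close> are the Cauchy-Riemann
  equations of the pair \<open>A\<close>, \<open>B\<close>; a real linear \<open>q\<close>, later a
  coordinate, turns the pair into an ordinary complex function.\<close>

lemma stem_differentiable:
  fixes A B :: "complex \<Rightarrow> quat"
  assumes "((\<lambda>(s, t). A (Complex s t)) has_derivative DA) (at (Re z, Im z))"
    and "((\<lambda>(s, t). B (Complex s t)) has_derivative DB) (at (Re z, Im z))"
    and "DA (1, 0) = DB (0, 1)" "DA (0, 1) = - DB (1, 0)" 
    and q: "bounded_linear q"
  shows "(\<lambda>z. Complex (q (A z)) (q (B z))) field_differentiable (at z)"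
proof -
  have pair: "((\<lambda>z. (Re z, Im z)) has_derivative (\<lambda>z. (Re z, Im z))) (at z)"
    by (auto intro!: derivative_eq_intros)
  interpret q: bounded_linear q by (rule q)
  have lin: "bounded_linear DA" "bounded_linear DB"
    using assms(1,2) by (auto intro: has_derivative_bounded_linear)
  have exp: "L (s, t) = s *\<^sub>R L (1, 0) + t *\<^sub>R L (0, 1)"
    if "bounded_linear L" for L :: "real \<times> real \<Rightarrow> quat" and s t
  proof -
    interpret L: bounded_linear L by (rule that)
    show ?thesis
      by (simp flip: L.add L.scaleR)
  qed
  have A: "((\<lambda>z. q (A z)) has_derivative (\<lambda>w. q (DA (Re w, Im w)))) (at z)"
    using q.has_derivative[OF has_derivative_compose[OF pair assms(1)]]
    by simp
  have B: "((\<lambda>z. q (B z)) has_derivative (\<lambda>w. q (DB (Re w, Im w)))) (at z)"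
    using q.has_derivative[OF has_derivative_compose[OF pair assms(2)]]
    by simp
  have "((\<lambda>z. of_real (q (A z)) + \<i> * of_real (q (B z))) has_derivative
      (\<lambda>w. of_real (q (DA (Re w, Im w))) + \<i> * of_real (q (DB (Re w, Im w))))) (at z)"
    by (intro derivative_intros A B has_derivative_of_real has_derivative_mult_right)
  \<comment> \<open>By the Cauchy-Riemann equations the real differential is multiplication by a
    single complex number.\<close>
  moreover have "of_real (q (DA (Re w, Im w))) + \<i> * of_real (q (DB (Re w, Im w)))
      = Complex (q (DA (1, 0))) (q (DB (1, 0))) * w" for w
    unfolding exp[OF lin(1), of "Re w" "Im w"] exp[OF lin(2), of "Re w" "Im w"]
    using assms(3,4)
    by (simp add: complex_eq_iff q.add q.diff q.scaleR q.neg mult.commute)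
  ultimately have "((\<lambda>z. Complex (q (A z)) (q (B z))) has_field_derivative
      Complex (q (DA (1, 0))) (q (DB (1, 0)))) (at z)"
    by (simp add: has_field_derivative_def Complex_eq)
  then show ?thesis
    by (auto simp: field_differentiable_def)
qed

section \<open>Correspondence between slice regular functions and stems\<close>

context
  fixes \<Omega> assumes ssd: "symmetric_slice_domain \<Omega>"
begin

lemma eq_on_slices:
  "eq_on \<Omega> f g \<longleftrightarrow>
     (\<forall>I\<in>imag_units. \<forall>z\<in>slice_trace \<Omega>. f (slice_embed I z) = g (slice_embed I z))"
proof
  assume *: "\<forall>I\<in>imag_units. \<forall>z\<in>slice_trace \<Omega>. f (slice_embed I z) = g (slice_embed I z)"
  show "eq_on \<Omega> f g"
    unfolding eq_on_def
  proof
    fix x assume "x \<in> \<Omega>"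
    then show "f x = g x"
      using * slice_unit_in[of x] slice_coord_in_trace[OF ssd, of x]
      by (metis slice_embed_slice_coord)
  qed
qed (auto simp: eq_on_def slice_trace_iff[OF ssd])

text \<open>The values at \<open>z\<close> and \<open>cnj z\<close> on one slice already determine
  both parts of the stem at \<open>z\<close>.\<close>

lemma is_stem_unique:
  assumes "is_stem \<Omega> f F" "is_stem \<Omega> g G"
  shows "eq_on \<Omega> f g \<longleftrightarrow> (\<forall>z\<in>slice_trace \<Omega>. F z = G z)"
proof
  assume eq: "eq_on \<Omega> f g"
  show "\<forall>z\<in>slice_trace \<Omega>. F z = G z"
  proof
    fix z assume z: "z \<in> slice_trace \<Omega>"
    have e: "stem_eval quat_i (F w) = stem_eval quat_i (G w)" if "w \<in> slice_trace \<Omega>" for w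
      using eq that assms quat_units(1) unfolding eq_on_slices is_stem_def by metis
    have "stem_eval quat_i (biquat_cnj (F z)) = stem_eval quat_i (biquat_cnj (G z))"
      using e[OF cnj_slice_trace[OF ssd z]] z assms by (simp add: is_stem_def)
    then have "quat_realpart (F z) = quat_realpart (G z)" "quat_imagpart (F z) = quat_imagpart (G z)"
      by (simp_all add: parts_eq_stem_eval[OF quat_units(1)] e[OF z])
    then show "F z = G z" by (metis biquat_of_parts_parts)
  qed
next
  assume "\<forall>z\<in>slice_trace \<Omega>. F z = G z"
  then show "eq_on \<Omega> f g"
    using assms by (simp add: eq_on_slices is_stem_def)
qed

lemma is_stem_stem_cong:
  assumes F: "is_stem \<Omega> f F" and eq: "\<And>z. z \<in> slice_trace \<Omega> \<Longrightarrow> F z = G z"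
  shows "is_stem \<Omega> f G"
proof -
  have "biquat_holomorphic G (slice_trace \<Omega>) \<longleftrightarrow> biquat_holomorphic F (slice_trace \<Omega>)"
    unfolding biquat_holomorphic_def by (intro arg_cong2[where f = "(\<and>)"] holomorphic_cong) (simp_all add: eq)
  then show ?thesis
    using F by (simp add: is_stem_def cnj_slice_trace[OF ssd] flip: eq)
qed

lemma is_stem_stem_function:
  assumes "biquat_holomorphic F (slice_trace \<Omega>)"
    and cnj: "\<And>z. z \<in> slice_trace \<Omega> \<Longrightarrow> F (cnj z) = biquat_cnj (F z)"
  shows "is_stem \<Omega> (stem_function F) F"
  unfolding is_stem_def
proof (intro conjI ballI assms)
  fix I z assume I: "I \<in> imag_units" and z: "z \<in> slice_trace \<Omega>"
  consider "Im z > 0" | "Im z < 0" | "Im z = 0" by linarith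
  then show "stem_function F (slice_embed I z) = stem_eval I (F z)"
  proof cases
    case 1
    then have "Complex (Re z) \<bar>Im z\<bar> = z" by (simp add: complex_eq_iff)
    then show ?thesis
      using 1 I by (simp add: stem_function_def slice_coord_slice_embed slice_unit_slice_embed)
  next
    \<comment> \<open>Here \<open>slice_unit\<close> returns \<open>- I\<close> and
      \<open>slice_coord\<close> returns \<open>cnj z\<close>; the conjugation condition cancels the
      two changes.\<close>
    case 2
    then have "Complex (Re z) \<bar>Im z\<bar> = cnj z" by (simp add: complex_eq_iff)
    then show ?thesis
      using 2 I cnj[OF z]
      by (simp add: stem_function_def slice_coord_slice_embed slice_unit_slice_embed stem_eval_cnj)
  next
    \<comment> \<open>At a real point \<open>slice_unit\<close> is a default value, but the
      conjugation condition kills the imaginary part of the stem, so every unit gives the same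
      value.\<close>
    case 3
    then have "Complex (Re z) \<bar>Im z\<bar> = z" "cnj z = z" by (simp_all add: complex_eq_iff)
    then have "biquat_cnj (F z) = F z" using cnj[OF z] by simp
    then have "quat_imagpart (F z) = - quat_imagpart (F z)" by (metis parts_cnj(2))
    then have "quat_imagpart (F z) = 0"
      by (simp add: quat_eq_iff quat_ops)
    then have "stem_eval J (F z) = stem_eval I (F z)" for J
      by (simp add: stem_eval_parts)
    then show ?thesis
      using \<open>Complex _ _ = z\<close> I by (simp add: stem_function_def slice_coord_slice_embed)
  qed
qed

text \<open>The open trace contains a real interval, and the classical identity theorem applies to
  each coordinate.\<close>

lemma stem_identity_theorem:
  assumes F: "biquat_holomorphic F (slice_trace \<Omega>)" and G: "biquat_holomorphic G (slice_trace \<Omega>)"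
    and eq: "\<And>r. complex_of_real r \<in> slice_trace \<Omega> \<Longrightarrow> F (of_real r) = G (of_real r)"
    and z: "z \<in> slice_trace \<Omega>"
  shows "F z = G z"
proof -
  obtain r0 :: real where r0: "of_real r0 \<in> slice_trace \<Omega>"
    by (rule real_in_slice_trace[OF ssd])
  then obtain e where e: "e > 0" "ball (of_real r0) e \<subseteq> slice_trace \<Omega>"
    using open_slice_trace[OF ssd] open_contains_ball by blast
  \<comment> \<open>The endpoint \<open>r0\<close> is a limit point of this interval and lies in the
    trace, as the identity theorem requires.\<close>
  let ?U = "complex_of_real ` {r0<..<r0 + e}"
  have U: "?U \<subseteq> slice_trace \<Omega>"
    using e by (auto simp: dist_norm subset_iff simp flip: of_real_diff)
  have lim: "complex_of_real r0 islimpt ?U"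
  proof (rule islimpt_isCont_image)
    show "r0 islimpt {r0<..<r0 + e}"
      using e(1) by (simp add: islimpt_greaterThanLessThan1)
    show "\<forall>\<^sub>F y in at r0. complex_of_real y \<noteq> of_real r0"
      by (auto simp: eventually_at_filter)
  qed auto
  have "f z = g z" if "f holomorphic_on slice_trace \<Omega>" "g holomorphic_on slice_trace \<Omega>"
    "\<And>r. complex_of_real r \<in> slice_trace \<Omega> \<Longrightarrow> f (of_real r) = g (of_real r)" for f g
  proof -
    have "f z - g z = 0"
    proof (rule analytic_continuation[OF _ open_slice_trace[OF ssd] connected_slice_trace[OF ssd]
          U r0 lim _ z])
      show "(\<lambda>z. f z - g z) holomorphic_on slice_trace \<Omega>"
        using that(1,2) by (rule holomorphic_on_diff)
    qed (use that(3) U in auto)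
    then show ?thesis by simp
  qed
  from this[of "\<lambda>z. bq0 (F z)" "\<lambda>z. bq0 (G z)"] this[of "\<lambda>z. bq1 (F z)" "\<lambda>z. bq1 (G z)"]
    this[of "\<lambda>z. bq2 (F z)" "\<lambda>z. bq2 (G z)"] this[of "\<lambda>z. bq3 (F z)" "\<lambda>z. bq3 (G z)"]
  show ?thesis
    using F G eq by (simp add: biquat_eq_iff biquat_holomorphic_def)
qed

text \<open>Each slice gives rise to a stem; all of them agree at real points, hence everywhere. This is
  the representation formula.\<close>

lemma slice_regular_imp_is_stem:
  assumes f: "f \<in> slice_regular \<Omega>"
  obtains F where "is_stem \<Omega> f F"
proof -
  \<comment> \<open>\<open>A\<close> and \<open>B\<close> solve \<open>f(z) = A + J B\<close> and
    \<open>f(cnj z) = A - J B\<close> on the slice of \<open>J\<close>. They are even and odd under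
    conjugation, so the stem condition holds by construction.\<close>
  define A where "A J z = (f (slice_embed J z) + f (slice_embed J (cnj z))) /\<^sub>R 2" for J z
  define B where "B J z = - (J * (f (slice_embed J z) - f (slice_embed J (cnj z)))) /\<^sub>R 2" for J z
  define F where "F J z = biquat_of_parts (A J z) (B J z)" for J z
  have F_cnj: "F J (cnj z) = biquat_cnj (F J z)" for J z
  proof -
    have "A J (cnj z) = A J z" "B J (cnj z) = - B J z"
      by (simp_all add: A_def B_def algebra_simps)
    then show ?thesis
      by (simp add: F_def biquat_of_parts_def biquat_eq_iff complex_eq_iff uminus_quat_def)
  qed
  have F_eval: "stem_eval J (F J z) = f (slice_embed J z)" if "J \<in> imag_units" for J z
  proof -
    have "J * B J z = (f (slice_embed J z) - f (slice_embed J (cnj z))) /\<^sub>R 2"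
      by (simp add: B_def imag_units_mult_self[OF that] scaleR_diff_right flip: mult.assoc)
    then have "A J z + J * B J z = f (slice_embed J z)"
      by (simp add: A_def flip: scaleR_add_right scaleR_2)
    then show ?thesis by (simp add: F_def stem_eval_of_parts)
  qed
  have F_hol: "biquat_holomorphic (F J) (slice_trace \<Omega>)" if J: "J \<in> imag_units" for J
  proof -
    have diff: "(\<lambda>z. Complex (q (A J z)) (q (B J z))) field_differentiable (at z)"
      if z: "z \<in> slice_trace \<Omega>" and q: "bounded_linear q" for z q
    proof -
      have reg: "\<exists>D. ((\<lambda>(s, t). f (of_real s + t *\<^sub>R J)) has_derivative D) (at (Re w, Im w)) \<and>
          (1/2) *\<^sub>R (D (1, 0) + J * D (0, 1)) = 0" if "w \<in> slice_trace \<Omega>" for w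
        using f J that by (simp add: slice_regular_def slice_trace_iff[OF ssd J] slice_embed_def)
      obtain D where D: "((\<lambda>(s, t). f (of_real s + t *\<^sub>R J)) has_derivative D) (at (Re z, Im z))"
        "D (1, 0) + J * D (0, 1) = 0"
        using reg[OF z] by auto
      \<comment> \<open>\<open>A\<close> and \<open>B\<close> also involve the conjugate point, so
        the derivative there enters, composed with the reflection.\<close>
      obtain E where E0: "((\<lambda>(s, t). f (of_real s + t *\<^sub>R J)) has_derivative E) (at (Re z, - Im z))"
        and E: "E (1, 0) + J * E (0, 1) = 0"
        using reg[OF cnj_slice_trace[OF ssd z]] by auto
      have D1: "((\<lambda>p. f (slice_embed J (Complex (fst p) (snd p)))) has_derivative D)
          (at (Re z, Im z))"
        using D(1) by (simp add: slice_embed_def case_prod_beta')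
      have refl: "((\<lambda>p::real \<times> real. (fst p, - snd p)) has_derivative (\<lambda>p. (fst p, - snd p)))
          (at (Re z, Im z))"
        by (auto intro!: derivative_eq_intros)
      have E1: "((\<lambda>p. f (slice_embed J (cnj (Complex (fst p) (snd p))))) has_derivative
          (\<lambda>p. E (fst p, - snd p))) (at (Re z, Im z))"
        using has_derivative_compose[OF refl, of "\<lambda>(s, t). f (of_real s + t *\<^sub>R J)" E] E0
        by (simp add: slice_embed_def case_prod_beta')
      have dA: "((\<lambda>(s, t). A J (Complex s t)) has_derivative
          (\<lambda>p. (D p + E (fst p, - snd p)) /\<^sub>R 2)) (at (Re z, Im z))"
        unfolding A_def case_prod_beta' by (intro derivative_intros D1 E1)
      have dB: "((\<lambda>(s, t). B J (Complex s t)) has_derivative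
          (\<lambda>p. - (J * (D p - E (fst p, - snd p))) /\<^sub>R 2)) (at (Re z, Im z))"
        unfolding B_def case_prod_beta' 
        by (intro derivative_intros D1 E1 has_derivative_mult_right)
      interpret E: bounded_linear E
        using E0 by (rule has_derivative_bounded_linear)
      have neg: "E (0, - 1) = - E (0, 1)"
        using E.neg[of "(0, 1)"] by simp
      have CR: "D (1, 0) = - (J * D (0, 1))" "E (1, 0) = - (J * E (0, 1))"
        using D(2) E by (simp_all add: eq_neg_iff_add_eq_0)
      show ?thesis
        by (rule stem_differentiable[OF dA dB _ _ q])
          (simp_all add: neg CR distrib_left right_diff_distrib imag_units_mult_self[OF J] scaleR_diff_right
            flip: mult.assoc)
    qed
    show ?thesis
      unfolding biquat_holomorphic_def F_def biquat_of_parts_def biquat.sel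
      by (simp add: holomorphic_on_open[OF open_slice_trace[OF ssd]] diff bounded_linear_qsel
          flip: field_differentiable_def)
  qed
  \<comment> \<open>At a real point \<open>B J\<close> vanishes and \<open>A J\<close> is the value
    of \<open>f\<close>, whatever \<open>J\<close> is.\<close>
  have real: "F J (of_real r) = F quat_i (of_real r)" for J and r :: real
    by (simp add: F_def A_def B_def)
  have "is_stem \<Omega> f (F quat_i)"
    unfolding is_stem_def
  proof (intro conjI ballI F_hol quat_units F_cnj)
    fix I z assume I: "I \<in> imag_units" and z: "z \<in> slice_trace \<Omega>"
    have "F I z = F quat_i z"
      by (rule stem_identity_theorem[OF F_hol[OF I] F_hol[OF quat_units(1)] real z])
    then show "f (slice_embed I z) = stem_eval I (F quat_i z)"
      by (metis F_eval[OF I])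
  qed
  then show ?thesis by (rule that)
qed

text \<open>In \<open>stem_eval\<close> the basis elements stand on the right, so left
  multiplication by \<open>J\<close> amounts to multiplying each complex coordinate by
  \<open>\<i>\<close>. Complex differentiability of the coordinates thus yields the Cauchy-Riemann
  equation on every slice.\<close>

lemma is_stem_imp_slice_regular:
  assumes F: "is_stem \<Omega> f F"
  shows "f \<in> slice_regular \<Omega>"
  unfolding slice_regular_def
proof (intro CollectI ballI allI impI)
  fix J \<alpha> \<beta> assume J: "J \<in> imag_units" and "of_real \<alpha> + \<beta> *\<^sub>R J \<in> \<Omega>"
  then have z: "Complex \<alpha> \<beta> \<in> slice_trace \<Omega>"
    by (simp add: slice_trace_iff[OF ssd J] slice_embed_def)
  have cpl: "bounded_linear (\<lambda>p. Complex (fst p) (snd p))"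
    unfolding Complex_eq
    by (intro bounded_linear_add bounded_linear_compose[OF bounded_linear_of_real bounded_linear_fst]
        bounded_linear_compose[OF bounded_linear_mult_right
          bounded_linear_compose[OF bounded_linear_of_real bounded_linear_snd]])
  have part: "((\<lambda>p. slice_embed J (g (Complex (fst p) (snd p))) * e) has_derivative
      (\<lambda>p. slice_embed J (deriv g (Complex \<alpha> \<beta>) * Complex (fst p) (snd p)) * e)) (at (\<alpha>, \<beta>))"
    if "g holomorphic_on slice_trace \<Omega>" for g e
  proof -
    have "(g has_field_derivative deriv g (Complex \<alpha> \<beta>)) (at (Complex \<alpha> \<beta>))"
      using that open_slice_trace[OF ssd] z by (rule holomorphic_derivI)
    then have "(g has_derivative (*) (deriv g (Complex \<alpha> \<beta>))) (at (Complex \<alpha> \<beta>))"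
      by (simp add: has_field_derivative_def)
    then have "((\<lambda>p. g (Complex (fst p) (snd p))) has_derivative
        (\<lambda>p. deriv g (Complex \<alpha> \<beta>) * Complex (fst p) (snd p))) (at (\<alpha>, \<beta>))"
      by (intro has_derivative_compose[OF bounded_linear_imp_has_derivative[OF cpl]]) simp
    then show ?thesis
      by (intro has_derivative_mult_left
          bounded_linear.has_derivative[OF bounded_linear_slice_embed])
  qed
  \<comment> \<open>The factor \<open>1\<close> gives the scalar summand the shape treated in
    \<open>part\<close>.\<close>
  define D where "D p = (let w = Complex (fst p) (snd p); d = (\<lambda>g. deriv g (Complex \<alpha> \<beta>)) in
    slice_embed J (d (\<lambda>z. bq0 (F z)) * w) * 1 + slice_embed J (d (\<lambda>z. bq1 (F z)) * w) * quat_i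
     + slice_embed J (d (\<lambda>z. bq2 (F z)) * w) * quat_j
     + slice_embed J (d (\<lambda>z. bq3 (F z)) * w) * quat_k)" for p
  have "((\<lambda>p. slice_embed J (bq0 (F (Complex (fst p) (snd p)))) * 1
     + slice_embed J (bq1 (F (Complex (fst p) (snd p)))) * quat_i
     + slice_embed J (bq2 (F (Complex (fst p) (snd p)))) * quat_j
     + slice_embed J (bq3 (F (Complex (fst p) (snd p)))) * quat_k) has_derivative D) (at (\<alpha>, \<beta>))"
    using F unfolding D_def Let_def is_stem_def biquat_holomorphic_def
    by (intro has_derivative_add part) auto
  then have stem: "((\<lambda>p. stem_eval J (F (Complex (fst p) (snd p)))) has_derivative D) (at (\<alpha>, \<beta>))"
    by (simp add: stem_eval_def)
  \<comment> \<open>\<open>F\<close> represents \<open>f\<close> only over the trace; its preimage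
    in the real plane is an open neighbourhood, which suffices for a derivative.\<close>
  let ?T = "(\<lambda>p. Complex (fst p) (snd p)) -` slice_trace \<Omega>"
  have "open ?T"
    using open_slice_trace[OF ssd] bounded_linear.continuous_on[OF cpl continuous_on_id]
    by (rule open_vimage)
  then have "((\<lambda>p. f (of_real (fst p) + snd p *\<^sub>R J)) has_derivative D) (at (\<alpha>, \<beta>))"
  proof (rule has_derivative_transform_within_open[OF stem])
    fix p assume "p \<in> ?T"
    then show "stem_eval J (F (Complex (fst p) (snd p))) = f (of_real (fst p) + snd p *\<^sub>R J)"
      using F J unfolding is_stem_def by (metis complex.sel slice_embed_def vimageE)
  qed (use z in simp)
  moreover have "D (1, 0) + J * D (0, 1) = 0"
  proof -
    have "J * slice_embed J (c * Complex 0 1) = - slice_embed J (c * Complex 1 0)" for c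
    proof -
      have "J * slice_embed J (c * Complex 0 1) = slice_embed J (\<i> * (c * Complex 0 1))"
        by (simp only: slice_embed_mult[OF J] slice_embed_ii)
      also have "\<i> * (c * Complex 0 1) = - (c * Complex 1 0)"
        by (simp add: complex_eq_iff)
      finally show ?thesis
        by (simp add: slice_embed_def)
    qed
    then show ?thesis
      by (simp add: D_def Let_def distrib_left flip: mult.assoc)
  qed
  ultimately show "\<exists>D. ((\<lambda>(s, t). f (of_real s + t *\<^sub>R J)) has_derivative D) (at (\<alpha>, \<beta>)) \<and>
      (1/2) *\<^sub>R (D (1, 0) + J * D (0, 1)) = 0"
    by (auto simp: case_prod_beta')
qed

section \<open>Function classes and the star product in terms of stems\<close>

lemma is_stem_const: "is_stem \<Omega> (\<lambda>_. q) (\<lambda>_. biquat_of_quat q)"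
proof -
  have "stem_eval I (biquat_of_quat q) = q" for I
    by (simp add: stem_eval_parts quat_realpart_def quat_imagpart_def biquat_of_quat_def)
      (simp flip: zero_quat_def)
  then show ?thesis
    by (simp add: is_stem_def biquat_holomorphic_const)
qed

lemma zero_on_iff_stem:
  assumes "is_stem \<Omega> f F"
  shows "f \<in> zero_on \<Omega> \<longleftrightarrow> (\<forall>z\<in>slice_trace \<Omega>. F z = 0)"
  using is_stem_unique[OF assms is_stem_const[of 0]]
  by (simp add: zero_on_def biquat_of_quat_def quat_ops flip: zero_biquat_def)

text \<open>The trace is invariant under conjugation, so preserving \<open>slice J\<close> controls
  both \<open>A + J B\<close> and \<open>A - J B\<close>.\<close>

lemma one_slice_preserving_iff_stem:
  assumes F: "is_stem \<Omega> f F" and J: "J \<in> imag_units"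
  shows "f \<in> one_slice_preserving \<Omega> J \<longleftrightarrow>
    (\<forall>z\<in>slice_trace \<Omega>. biquat_of_quat J * F z = F z * biquat_of_quat J)"
proof -
  have "\<Omega> \<inter> slice J = slice_embed J ` slice_trace \<Omega>"
    by (auto simp: slice_eq_range slice_trace_iff[OF ssd J])
  then have "f ` (\<Omega> \<inter> slice J) \<subseteq> slice J \<longleftrightarrow>
      (\<forall>z\<in>slice_trace \<Omega>. stem_eval J (F z) \<in> slice J)"
    using F J by (simp add: is_stem_def image_subset_iff)
  also have "\<dots> \<longleftrightarrow> (\<forall>z\<in>slice_trace \<Omega>. stem_eval J (F z) \<in> slice J \<and>
      stem_eval J (biquat_cnj (F z)) \<in> slice J)"
  proof (intro iffI ballI conjI)
    fix z assume "\<forall>z\<in>slice_trace \<Omega>. stem_eval J (F z) \<in> slice J" and z: "z \<in> slice_trace \<Omega>"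
    then have "stem_eval J (F (cnj z)) \<in> slice J"
      using cnj_slice_trace[OF ssd] by blast
    then show "stem_eval J (biquat_cnj (F z)) \<in> slice J"
      using F z by (simp add: is_stem_def)
  qed auto
  also have "\<dots> \<longleftrightarrow> (\<forall>z\<in>slice_trace \<Omega>. biquat_of_quat J * F z = F z * biquat_of_quat J)"
    by (simp add: stem_eval_in_slice_iff[OF J])
  finally show ?thesis
    using is_stem_imp_slice_regular[OF F] by (simp add: one_slice_preserving_def)
qed

lemma slice_preserving_iff_one_slice:
  "f \<in> slice_preserving \<Omega> \<longleftrightarrow> (\<forall>J\<in>imag_units. f \<in> one_slice_preserving \<Omega> J)"
  using quat_units by (auto simp: slice_preserving_def one_slice_preserving_def)

text \<open>Only scalars commute with both \<open>i\<close> and \<open>j\<close>, and scalars are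
  central.\<close>

lemma slice_preserving_iff_stem:
  assumes F: "is_stem \<Omega> f F"
  shows "f \<in> slice_preserving \<Omega> \<longleftrightarrow>
    (\<forall>z\<in>slice_trace \<Omega>. F z = biquat_of_complex (bq0 (F z)))"
proof
  assume "f \<in> slice_preserving \<Omega>"
  then have "\<forall>z\<in>slice_trace \<Omega>. biquat_of_quat J * F z = F z * biquat_of_quat J"
    if "J \<in> imag_units" for J
    using that by (simp add: slice_preserving_iff_one_slice one_slice_preserving_iff_stem[OF F])
  from this[OF quat_units(1)] this[OF quat_units(2)]
  show "\<forall>z\<in>slice_trace \<Omega>. F z = biquat_of_complex (bq0 (F z))"
    by (simp add: biquat_eq_iff biquat_of_complex_def biquat_of_quat_def quat_i_def quat_j_def
        times_biquat_def)
next
  assume *: "\<forall>z\<in>slice_trace \<Omega>. F z = biquat_of_complex (bq0 (F z))"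
  have "q * F z = F z * q" if "z \<in> slice_trace \<Omega>" for q z
    using bspec[OF * that] biquat_of_complex_commute[of "bq0 (F z)" q] by simp
  then show "f \<in> slice_preserving \<Omega>"
    by (simp add: slice_preserving_iff_one_slice one_slice_preserving_iff_stem[OF F])
qed

text \<open>The components of any decomposition have scalar stems, which assemble to a stem of
  \<open>f\<close>; stems are unique. Hence the choice in \<open>slice_components\<close> does not
  affect values on \<open>\<Omega>\<close>.\<close>

lemma slice_decomposition_stem:
  assumes F: "is_stem \<Omega> f F" and C: "slice_decomposition \<Omega> f C"
    and I: "I \<in> imag_units" and z: "z \<in> slice_trace \<Omega>"
  shows "C 0 (slice_embed I z) = slice_embed I (bq0 (F z))"
    "C 1 (slice_embed I z) = slice_embed I (bq1 (F z))"
    "C 2 (slice_embed I z) = slice_embed I (bq2 (F z))"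
    "C 3 (slice_embed I z) = slice_embed I (bq3 (F z))"
proof -
  have "\<exists>P. is_stem \<Omega> (C n) (\<lambda>z. biquat_of_complex (P z))" if "n \<in> {0, 1, 2, 3}" for n
  proof -
    have C': "C n \<in> slice_preserving \<Omega>"
      using C that unfolding slice_decomposition_def by blast
    then have "C n \<in> slice_regular \<Omega>"
      by (simp add: slice_preserving_def)
    then obtain G where G: "is_stem \<Omega> (C n) G"
      by (rule slice_regular_imp_is_stem)
    have *: "\<forall>z\<in>slice_trace \<Omega>. G z = biquat_of_complex (bq0 (G z))"
      using C' unfolding slice_preserving_iff_stem[OF G] .
    have "is_stem \<Omega> (C n) (\<lambda>z. biquat_of_complex (bq0 (G z)))"
      by (rule is_stem_stem_cong[OF G]) (use * in blast)
    then show ?thesis by (rule exI[of _ "\<lambda>z. bq0 (G z)"])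
  qed
  then have "\<forall>n\<in>{0, 1, 2, 3}. \<exists>P. is_stem \<Omega> (C n) (\<lambda>z. biquat_of_complex (P z))"
    by (rule ballI)
  from bchoice[OF this] obtain P where
    P: "\<And>n. n \<in> {0, 1, 2, 3} \<Longrightarrow> is_stem \<Omega> (C n) (\<lambda>z. biquat_of_complex (P n z))"
    by blast
  define G where "G z = Biquat (P 0 z) (P 1 z) (P 2 z) (P 3 z)" for z
  have P_eval: "C n (slice_embed I z) = slice_embed I (P n z)"
    if "n \<in> {0, 1, 2, 3}" "I \<in> imag_units" "z \<in> slice_trace \<Omega>" for n I z
    using P[OF that(1)] that(2,3) by (simp add: is_stem_def stem_eval_def biquat_of_complex_def)
  have P_cnj: "P n (cnj z) = cnj (P n z)" if "n \<in> {0, 1, 2, 3}" "z \<in> slice_trace \<Omega>" for n z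
    using P[OF that(1)] that(2) by (simp add: is_stem_def biquat_of_complex_def biquat_cnj_def)
  have P_hol: "P n holomorphic_on slice_trace \<Omega>" if "n \<in> {0, 1, 2, 3}" for n
    using P[OF that(1)] by (simp add: is_stem_def biquat_of_complex_def biquat_holomorphic_def)
  have "is_stem \<Omega> (\<lambda>x. C 0 x + C 1 x * quat_i + C 2 x * quat_j + C 3 x * quat_k) G"
    using P_hol P_cnj P_eval
    by (simp add: is_stem_def biquat_holomorphic_def G_def biquat_cnj_def stem_eval_def)
  then have "\<forall>z\<in>slice_trace \<Omega>. F z = G z"
    using is_stem_unique[OF F] C by (simp add: slice_decomposition_def)
  then show "C 0 (slice_embed I z) = slice_embed I (bq0 (F z))"
    "C 1 (slice_embed I z) = slice_embed I (bq1 (F z))"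
    "C 2 (slice_embed I z) = slice_embed I (bq2 (F z))"
    "C 3 (slice_embed I z) = slice_embed I (bq3 (F z))"
    using z I by (simp_all add: P_eval G_def)
qed

text \<open>The four coordinates of the stem induce a decomposition, so the choice operator has a
  witness.\<close>

lemma slice_decomposition_slice_components:
  assumes F: "is_stem \<Omega> f F"
  shows "slice_decomposition \<Omega> f (slice_components \<Omega> f)"
proof -
  define sel where "sel n = (if n = 0 then bq0 else if n = 1 then bq1 else if n = 2 then bq2 else bq3)"
    for n :: nat
  define C where "C n = stem_function (\<lambda>z. biquat_of_complex (sel n (F z)))" for n
  have C: "is_stem \<Omega> (C n) (\<lambda>z. biquat_of_complex (sel n (F z)))" for n
    unfolding C_def using F
    by (intro is_stem_stem_function)
      (auto simp: is_stem_def biquat_holomorphic_def biquat_of_complex_def biquat_cnj_def sel_def)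
  have "C n \<in> slice_preserving \<Omega>" for n
    using slice_preserving_iff_stem[OF C] by (simp add: biquat_of_complex_def)
  moreover have "eq_on \<Omega> f (\<lambda>x. C 0 x + C 1 x * quat_i + C 2 x * quat_j + C 3 x * quat_k)"
    using F C by (simp add: eq_on_slices is_stem_def stem_eval_def biquat_of_complex_def sel_def)
  ultimately have "slice_decomposition \<Omega> f C"
    by (simp add: slice_decomposition_def)
  then show ?thesis
    unfolding slice_components_def by (rule someI[of "slice_decomposition \<Omega> f"])
qed

text \<open>On a fixed slice \<open>slice_embed I\<close> is additive and multiplicative, so the
  formula of \<open>star\<close> becomes the coordinate formula of the biquaternion product.
  Associativity is then that of a ring.\<close>

lemma is_stem_star:
  assumes F: "is_stem \<Omega> f F" and G: "is_stem \<Omega> g G"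
  shows "is_stem \<Omega> (star \<Omega> f g) (\<lambda>z. F z * G z)"
  unfolding is_stem_def
proof (intro conjI ballI)
  show "biquat_holomorphic (\<lambda>z. F z * G z) (slice_trace \<Omega>)"
    using F G by (auto simp: is_stem_def intro: biquat_holomorphic_mult)
  show "F (cnj z) * G (cnj z) = biquat_cnj (F z * G z)" if "z \<in> slice_trace \<Omega>" for z
    using F G that by (simp add: is_stem_def biquat_cnj_mult)
  fix I z assume I: "I \<in> imag_units" and z: "z \<in> slice_trace \<Omega>"
  note comp = slice_decomposition_stem[OF F slice_decomposition_slice_components[OF F] I z]
    slice_decomposition_stem[OF G slice_decomposition_slice_components[OF G] I z]
  show "star \<Omega> f g (slice_embed I z) = stem_eval I (F z * G z)"
    unfolding star_def Let_def comp
    by (simp add: stem_eval_def times_biquat_def slice_embed_add slice_embed_diff distrib_left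
        distrib_right left_diff_distrib mult.commute[of "bq0 (G z)"] flip: mult.assoc slice_embed_mult[OF I])
qed

end


section \<open>Intertwining relations\<close>

text \<open>The complex linear extension of the inner product with \<open>J\<close>; for
  \<open>w\<close> commuting with a unit \<open>J\<close> it is the coefficient of \<open>J\<close>
  in \<open>w\<close>.\<close>

definition biquat_dot :: "quat \<Rightarrow> biquat \<Rightarrow> complex" where
  "biquat_dot J w = of_real (qIm1 J) * bq1 w + of_real (qIm2 J) * bq2 w + of_real (qIm3 J) * bq3 w"

text \<open>The complex quadratic form extending the squared norm, not the Hermitian one; it stays
  multiplicative by Euler's four-square identity.\<close>

definition biquat_norm :: "biquat \<Rightarrow> complex" where
  "biquat_norm w = (bq0 w)\<^sup>2 + (bq1 w)\<^sup>2 + (bq2 w)\<^sup>2 + (bq3 w)\<^sup>2"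

lemma biquat_norm_mult: "biquat_norm (v * w) = biquat_norm v * biquat_norm w"
  by (simp add: biquat_norm_def times_biquat_def power2_eq_square algebra_simps)

lemma bq0_mult_commute: "bq0 (v * w) = bq0 (w * v)"
  by (simp add: times_biquat_def algebra_simps)

text \<open>As over the reals, commuting with \<open>J\<close> makes the vector part proportional to
  \<open>J\<close>, with a coefficient found by pairing with \<open>J\<close>.\<close>

lemma biquat_commute_decompose:
  assumes J: "J \<in> imag_units" and comm: "biquat_of_quat J * w = w * biquat_of_quat J"
  shows "w = biquat_of_complex (bq0 w) + biquat_of_complex (biquat_dot J w) * biquat_of_quat J"
    and "biquat_norm w = (bq0 w)\<^sup>2 + (biquat_dot J w)\<^sup>2"
proof -
  have unit: "qRe J = 0" "qIm1 J * qIm1 J + qIm2 J * qIm2 J + qIm3 J * qIm3 J = 1"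
    using J by (simp_all add: imag_units_iff power2_eq_square)
  define c1 c2 c3 where c: "c1 = complex_of_real (qIm1 J)" "c2 = complex_of_real (qIm2 J)"
    "c3 = complex_of_real (qIm3 J)"
  have one: "c1 * c1 + c2 * c2 + c3 * c3 = 1"
    using arg_cong[OF unit(2), of complex_of_real] by (simp add: c)
  have d: "biquat_dot J w = c1 * bq1 w + c2 * bq2 w + c3 * bq3 w"
    by (simp add: biquat_dot_def c)
  have "c2 * bq3 w = c3 * bq2 w" "c3 * bq1 w = c1 * bq3 w" "c1 * bq2 w = c2 * bq1 w"
    using comm unit(1)
    by (simp_all add: biquat_eq_iff times_biquat_def biquat_of_quat_def algebra_simps c)
  then have w: "bq1 w = biquat_dot J w * c1" "bq2 w = biquat_dot J w * c2"
    "bq3 w = biquat_dot J w * c3"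
    unfolding d using one by algebra+
  then show "w = biquat_of_complex (bq0 w) + biquat_of_complex (biquat_dot J w) * biquat_of_quat J"
    using unit(1)
    by (simp add: biquat_eq_iff biquat_of_complex_def biquat_of_quat_def plus_biquat_def
        times_biquat_def c)
  have "(bq1 w)\<^sup>2 + (bq2 w)\<^sup>2 + (bq3 w)\<^sup>2 = (biquat_dot J w)\<^sup>2 * (c1 * c1 + c2 * c2 + c3 * c3)"
    by (subst w(1), subst w(2), subst w(3)) (simp add: power2_eq_square algebra_simps)
  then have "(bq1 w)\<^sup>2 + (bq2 w)\<^sup>2 + (bq3 w)\<^sup>2 = (biquat_dot J w)\<^sup>2"
    unfolding one by simp
  then show "biquat_norm w = (bq0 w)\<^sup>2 + (biquat_dot J w)\<^sup>2"
    by (simp add: biquat_norm_def add.assoc)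
qed

text \<open>Biquaternions have zero divisors, so the cancellation is by a scalar factor, one
  coordinate at a time.\<close>

lemma holomorphic_scale_biquat_eq_0:
  assumes "open D" "connected D" "p holomorphic_on D" "biquat_holomorphic G D"
    and eq: "\<And>z. z \<in> D \<Longrightarrow> biquat_of_complex (p z) * G z = 0"
  shows "(\<forall>z\<in>D. p z = 0) \<or> (\<forall>z\<in>D. G z = 0)"
proof (rule disjCI)
  assume nz: "\<not> (\<forall>z\<in>D. G z = 0)"
  have eqs: "p z * bq0 (G z) = 0" "p z * bq1 (G z) = 0" "p z * bq2 (G z) = 0" "p z * bq3 (G z) = 0"
    if "z \<in> D" for z
    using eq[OF that] by (simp_all add: biquat_eq_iff biquat_ops biquat_of_complex_def)
  have "(\<forall>z\<in>D. p z = 0) \<or> (\<forall>z\<in>D. g z = 0)"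
    if "g holomorphic_on D" "\<And>z. z \<in> D \<Longrightarrow> p z * g z = 0" for g
    using assms(1-3) that by (rule holomorphic_mult_eq_0)
  from this[of "\<lambda>z. bq0 (G z)"] this[of "\<lambda>z. bq1 (G z)"] this[of "\<lambda>z. bq2 (G z)"]
    this[of "\<lambda>z. bq3 (G z)"]
  show "\<forall>z\<in>D. p z = 0"
    using nz assms(4) eqs by (auto simp: biquat_holomorphic_def biquat_eq_iff zero_biquat_def)
qed

text \<open>The sign is an integer so that \<open>of_int\<close> can place it in each of the
  algebras involved.\<close>

definition intertwined :: "complex set \<Rightarrow> quat \<Rightarrow> quat \<Rightarrow> int \<Rightarrow> (complex \<Rightarrow> biquat) \<Rightarrow> bool" where
  "intertwined D I M \<epsilon> F \<longleftrightarrow>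
     (\<forall>z\<in>D. biquat_of_quat I * F z = of_int \<epsilon> * (F z * biquat_of_quat M))"

context
  fixes \<Omega> assumes ssd: "symmetric_slice_domain \<Omega>"
begin

text \<open>Passing through \<open>F\<close> turns \<open>I\<close> into \<open>M\<close>, passing
  through \<open>H\<close> turns it back, and the two signs cancel.\<close>

lemma intertwined_imp_one_slice_preserving:
  assumes F: "is_stem \<Omega> f F" and H: "is_stem \<Omega> h H" and I: "I \<in> imag_units"
    and \<epsilon>: "\<epsilon> \<in> {1, -1}"
    and tw: "intertwined (slice_trace \<Omega>) I M \<epsilon> F" "intertwined (slice_trace \<Omega>) M I \<epsilon> H"
  shows "star \<Omega> f h \<in> one_slice_preserving \<Omega> I"
  unfolding one_slice_preserving_iff_stem[OF ssd is_stem_star[OF ssd F H] I]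
proof
  fix z assume z: "z \<in> slice_trace \<Omega>"
  have "biquat_of_quat I * (F z * H z) = of_int \<epsilon> * F z * (biquat_of_quat M * H z)"
    using tw(1) z by (simp add: intertwined_def flip: mult.assoc)
  also have "\<dots> = F z * H z * biquat_of_quat I"
    using tw(2) z \<epsilon> by (auto simp: intertwined_def mult.assoc)
  finally show "biquat_of_quat I * (F z * H z) = F z * H z * biquat_of_quat I" .
qed

text \<open>\<open>f * h\<close> and \<open>h * f\<close> have equal real parts and equal norms, so the squares of their components
  along \<open>I\<close> and \<open>M\<close> agree.\<close>

lemma biquat_dot_star_squares:
  assumes F: "is_stem \<Omega> f F" and H: "is_stem \<Omega> h H" and I: "I \<in> imag_units" and M: "M \<in> imag_units"
    and "star \<Omega> f h \<in> one_slice_preserving \<Omega> I" "star \<Omega> h f \<in> one_slice_preserving \<Omega> M"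
    and z: "z \<in> slice_trace \<Omega>"
  shows "(biquat_dot I (F z * H z))\<^sup>2 = (biquat_dot M (H z * F z))\<^sup>2"
proof -
  have "biquat_of_quat I * (F z * H z) = F z * H z * biquat_of_quat I"
    "biquat_of_quat M * (H z * F z) = H z * F z * biquat_of_quat M"
    using assms by (simp_all add: one_slice_preserving_iff_stem[OF ssd is_stem_star[OF ssd]])
  then have "biquat_norm (F z * H z) = (bq0 (F z * H z))\<^sup>2 + (biquat_dot I (F z * H z))\<^sup>2"
    "biquat_norm (H z * F z) = (bq0 (H z * F z))\<^sup>2 + (biquat_dot M (H z * F z))\<^sup>2"
    by (simp_all add: biquat_commute_decompose(2) I M)
  then show ?thesis
    by (simp add: biquat_norm_mult bq0_mult_commute[of "F z"] mult.commute)
qed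

text \<open>If the coefficient of \<open>h * f\<close> along \<open>M\<close> vanishes, so does that
  of \<open>f * h\<close> along \<open>I\<close>, having the same square. This carries the exclusion
  of slice preserving products from one order of the factors to the other.\<close>

lemma star_slice_preserving_commute:
  assumes F: "is_stem \<Omega> f F" and H: "is_stem \<Omega> h H" and I: "I \<in> imag_units" and M: "M \<in> imag_units"
    and S: "star \<Omega> f h \<in> one_slice_preserving \<Omega> I" "star \<Omega> h f \<in> one_slice_preserving \<Omega> M"
    and real: "star \<Omega> h f \<in> slice_preserving \<Omega>"
  shows "star \<Omega> f h \<in> slice_preserving \<Omega>"
  unfolding slice_preserving_iff_stem[OF ssd is_stem_star[OF ssd F H]]
proof
  fix z assume z: "z \<in> slice_trace \<Omega>"
  have "H z * F z = biquat_of_complex (bq0 (H z * F z))"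
    using real z by (simp add: slice_preserving_iff_stem[OF ssd is_stem_star[OF ssd H F]])
  then have "biquat_dot M (H z * F z) = 0"
    by (metis biquat.sel biquat_dot_def biquat_of_complex_def add_0 mult_zero_right)
  then have "biquat_dot I (F z * H z) = 0"
    using biquat_dot_star_squares[OF F H I M S z] by simp
  moreover have "biquat_of_quat I * (F z * H z) = F z * H z * biquat_of_quat I"
    using S(1) z by (simp add: one_slice_preserving_iff_stem[OF ssd is_stem_star[OF ssd F H] I])
  ultimately show "F z * H z = biquat_of_complex (bq0 (F z * H z))"
    using biquat_commute_decompose(1)[OF I, of "F z * H z"]
    by (simp add: biquat_of_complex_def[of 0] flip: zero_biquat_def)
qed

text \<open>With \<open>f * h = p + q I\<close> and \<open>h * f = p \<plusminus> q M\<close>, associativity of \<open>f * h * f\<close> gives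
  \<open>q (I f \<minusplus> f M) = 0\<close>, and \<open>q\<close> is not identically zero.\<close>

lemma one_slice_preserving_imp_intertwined:
  assumes F: "is_stem \<Omega> f F" and H: "is_stem \<Omega> h H" and I: "I \<in> imag_units" and M: "M \<in> imag_units"
    and S: "star \<Omega> f h \<in> one_slice_preserving \<Omega> I" "star \<Omega> h f \<in> one_slice_preserving \<Omega> M"
    and nreal: "star \<Omega> f h \<notin> slice_preserving \<Omega>"
  obtains \<epsilon> where "\<epsilon> \<in> {1, -1}"
    "intertwined (slice_trace \<Omega>) I M \<epsilon> F" "intertwined (slice_trace \<Omega>) M I \<epsilon> H"
proof -
  let ?D = "slice_trace \<Omega>"
  define p q r where pqr: "p z = bq0 (F z * H z)" "q z = biquat_dot I (F z * H z)"
    "r z = biquat_dot M (H z * F z)" for z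
  have hol: "biquat_holomorphic F ?D" "biquat_holomorphic H ?D"
    using F H by (simp_all add: is_stem_def)
  have dot_hol: "(\<lambda>z. biquat_dot J (G z)) holomorphic_on ?D" if "biquat_holomorphic G ?D" for J G
    using that unfolding biquat_dot_def biquat_holomorphic_def by (auto intro!: holomorphic_intros)
  have qr_hol: "q holomorphic_on ?D" "r holomorphic_on ?D"
    unfolding pqr by (intro dot_hol biquat_holomorphic_mult hol)+
  have FH: "F z * H z = biquat_of_complex (p z) + biquat_of_complex (q z) * biquat_of_quat I"
    if "z \<in> ?D" for z
    unfolding pqr using S(1) that
    by (intro biquat_commute_decompose(1)[OF I])
      (simp add: one_slice_preserving_iff_stem[OF ssd is_stem_star[OF ssd F H] I])
  have HF: "H z * F z = biquat_of_complex (p z) + biquat_of_complex (r z) * biquat_of_quat M"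
    if "z \<in> ?D" for z
    unfolding pqr bq0_mult_commute[of "F z"] using S(2) that
    by (intro biquat_commute_decompose(1)[OF M])
      (simp add: one_slice_preserving_iff_stem[OF ssd is_stem_star[OF ssd H F] M])
  \<comment> \<open>The squares agree pointwise; the absence of zero divisors makes the sign the
    same on the whole trace.\<close>
  have "(q z - r z) * (q z + r z) = 0" if "z \<in> ?D" for z
    using biquat_dot_star_squares[OF F H I M S that]
    by (simp add: pqr power2_eq_square algebra_simps)
  then have "(\<forall>z\<in>?D. q z - r z = 0) \<or> (\<forall>z\<in>?D. q z + r z = 0)"
    by (intro holomorphic_mult_eq_0 open_slice_trace[OF ssd] connected_slice_trace[OF ssd]
        holomorphic_intros qr_hol)
  then obtain \<epsilon> :: int where \<epsilon>: "\<epsilon> \<in> {1, -1}" and r: "\<And>z. z \<in> ?D \<Longrightarrow> r z = of_int \<epsilon> * q z"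
    by (auto simp: eq_neg_iff_add_eq_0 add.commute intro: that[of 1] that[of "-1"])
  have q_nz: "\<not> (\<forall>z\<in>?D. q z = 0)"
  proof
    assume "\<forall>z\<in>?D. q z = 0"
    then have "F z * H z = biquat_of_complex (p z)" if "z \<in> ?D" for z
      using FH[OF that] that by (simp add: biquat_of_complex_def[of 0] flip: zero_biquat_def)
    then show False
      using nreal by (simp add: slice_preserving_iff_stem[OF ssd is_stem_star[OF ssd F H]] pqr)
  qed
  have q_cancel: "\<forall>z\<in>?D. G z = 0"
    if "biquat_holomorphic G ?D" "\<And>z. z \<in> ?D \<Longrightarrow> biquat_of_complex (q z) * G z = 0" for G
    using holomorphic_scale_biquat_eq_0[OF open_slice_trace[OF ssd] connected_slice_trace[OF ssd]
        qr_hol(1) that] q_nz by blast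
  have r': "biquat_of_complex (r z) = of_int \<epsilon> * biquat_of_complex (q z)" if "z \<in> ?D" for z
    using r[OF that] \<epsilon> by (auto simp: biquat_of_complex_def biquat_ops)
  have eps: "of_int \<epsilon> * w = w * of_int \<epsilon>" "of_int \<epsilon> * (of_int \<epsilon> * w) = w" for w :: biquat
    using \<epsilon> by auto
  have eps_const: "(of_int \<epsilon> :: biquat) = biquat_of_complex (of_int \<epsilon>)"
    using \<epsilon> by (auto simp: biquat_of_complex_def biquat_ops)
  have "\<forall>z\<in>?D. biquat_of_quat I * F z - of_int \<epsilon> * (F z * biquat_of_quat M) = 0"
  proof (rule q_cancel)
    show "biquat_holomorphic (\<lambda>z. biquat_of_quat I * F z - of_int \<epsilon> * (F z * biquat_of_quat M)) ?D"
      by (intro biquat_holomorphic_diff biquat_holomorphic_mult biquat_holomorphic_const hol)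
    fix z assume z: "z \<in> ?D"
    let ?p = "biquat_of_complex (p z)" and ?q = "biquat_of_complex (q z)"
    \<comment> \<open>Both sides are \<open>F z * H z * F z\<close>, bracketed in two ways.\<close>
    have "(?p + ?q * biquat_of_quat I) * F z = F z * (?p + of_int \<epsilon> * ?q * biquat_of_quat M)"
      using FH[OF z] HF[OF z] r'[OF z] by (metis mult.assoc)
    moreover have "F z * ?p = ?p * F z" "F z * (of_int \<epsilon> * ?q * biquat_of_quat M) =
        ?q * (of_int \<epsilon> * (F z * biquat_of_quat M))"
      unfolding eps_const by (metis biquat_of_complex_commute mult.assoc)+
    ultimately show "?q * (biquat_of_quat I * F z - of_int \<epsilon> * (F z * biquat_of_quat M)) = 0"
      by (simp add: distrib_left distrib_right right_diff_distrib mult.assoc)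
  qed
  moreover have "\<forall>z\<in>?D. biquat_of_quat M * H z - of_int \<epsilon> * (H z * biquat_of_quat I) = 0"
  proof (rule q_cancel)
    show "biquat_holomorphic (\<lambda>z. biquat_of_quat M * H z - of_int \<epsilon> * (H z * biquat_of_quat I)) ?D"
      by (intro biquat_holomorphic_diff biquat_holomorphic_mult biquat_holomorphic_const hol)
    fix z assume z: "z \<in> ?D"
    let ?p = "biquat_of_complex (p z)" and ?q = "biquat_of_complex (q z)"
    \<comment> \<open>The same with \<open>H z * F z * H z\<close>.\<close>
    have "(?p + of_int \<epsilon> * ?q * biquat_of_quat M) * H z = H z * (?p + ?q * biquat_of_quat I)"
      using FH[OF z] HF[OF z] r'[OF z] by (metis mult.assoc)
    moreover have "H z * ?p = ?p * H z" "H z * (?q * biquat_of_quat I) = ?q * (H z * biquat_of_quat I)"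
      by (metis biquat_of_complex_commute mult.assoc)+
    ultimately have "of_int \<epsilon> * (?q * (biquat_of_quat M * H z)) = ?q * (H z * biquat_of_quat I)"
      by (simp add: distrib_left distrib_right mult.assoc)
    \<comment> \<open>Here the sign sits on the wrong side; multiplying by \<open>\<epsilon>\<close>
      moves it across, as its square is 1.\<close>
    then have "of_int \<epsilon> * (of_int \<epsilon> * (?q * (biquat_of_quat M * H z))) =
        ?q * (of_int \<epsilon> * (H z * biquat_of_quat I))"
      by (metis eps(1) mult.assoc)
    then show "?q * (biquat_of_quat M * H z - of_int \<epsilon> * (H z * biquat_of_quat I)) = 0"
      by (simp add: eps(2) right_diff_distrib)
  qed
  ultimately show ?thesis
    using that[OF \<epsilon>] by (simp add: intertwined_def)
qed

text \<open>The constant \<open>v\<close> satisfies the same relation as \<open>F\<close>, so in the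
  quotient \<open>F v^-1\<close> the unit \<open>M\<close> and the sign cancel and only commutation
  with \<open>I\<close> remains.\<close>

lemma intertwined_right_factor:
  assumes F: "is_stem \<Omega> f F" and nz: "f \<notin> zero_on \<Omega>" and I: "I \<in> imag_units"
    and \<epsilon>: "\<epsilon> \<in> {1, -1}" and v: "v \<noteq> 0" "I * v = of_int \<epsilon> * (v * M)"
  shows "intertwined (slice_trace \<Omega>) I M \<epsilon> F \<longleftrightarrow>
    (\<exists>f'\<in>one_slice_preserving \<Omega> I - zero_on \<Omega>. eq_on \<Omega> f (star \<Omega> f' (\<lambda>_. v)))"
proof -
  let ?b = biquat_of_quat
  have bv: "?b I * ?b v = of_int \<epsilon> * (?b v * ?b M)"
    using arg_cong[OF v(2), of ?b] \<epsilon>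
    by (auto simp: biquat_of_quat_mult biquat_of_quat_uminus biquat_of_quat_1)
  have inv: "?b (inverse v) * ?b v = 1" "?b v * ?b (inverse v) = 1"
    using v(1) by (simp_all flip: biquat_of_quat_mult add: biquat_of_quat_1)
  show ?thesis
  proof
    assume tw: "intertwined (slice_trace \<Omega>) I M \<epsilon> F"
    define F' where "F' z = F z * ?b (inverse v)" for z
    have F': "is_stem \<Omega> (stem_function F') F'"
    proof (rule is_stem_stem_function[OF ssd])
      show "biquat_holomorphic F' (slice_trace \<Omega>)"
        using F unfolding F'_def is_stem_def
        by (intro biquat_holomorphic_mult biquat_holomorphic_const) auto
    qed (use F in \<open>simp add: F'_def is_stem_def biquat_cnj_mult\<close>)
    have star: "is_stem \<Omega> (star \<Omega> (stem_function F') (\<lambda>_. v)) (\<lambda>z. F' z * ?b v)"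
      by (intro is_stem_star[OF ssd] F' is_stem_const[OF ssd])
    have FF': "F z = F' z * ?b v" for z
      by (simp add: F'_def mult.assoc inv)
    have "eq_on \<Omega> f (star \<Omega> (stem_function F') (\<lambda>_. v))"
      unfolding is_stem_unique[OF ssd F star] by (simp add: FF')
    moreover have "stem_function F' \<notin> zero_on \<Omega>"
      using nz unfolding zero_on_iff_stem[OF ssd F'] zero_on_iff_stem[OF ssd F]
      by (metis FF' mult_zero_left)
    moreover have "stem_function F' \<in> one_slice_preserving \<Omega> I"
      unfolding one_slice_preserving_iff_stem[OF ssd F' I]
    proof
      fix z assume "z \<in> slice_trace \<Omega>"
      then have "?b I * F' z = of_int \<epsilon> * (F z * (?b M * ?b (inverse v)))"
        using tw by (simp add: F'_def intertwined_def flip: mult.assoc)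
      \<comment> \<open>Inserting \<open>v^-1 v\<close> produces \<open>v M\<close>, to which the
        relation for \<open>v\<close> applies.\<close>
      also have "?b M * ?b (inverse v) = ?b (inverse v) * (?b v * ?b M) * ?b (inverse v)"
        by (simp add: inv flip: mult.assoc)
      also have "?b v * ?b M = of_int \<epsilon> * (?b I * ?b v)"
        using \<epsilon> by (auto simp: bv)
      also have "?b (inverse v) * (of_int \<epsilon> * (?b I * ?b v)) * ?b (inverse v) =
          of_int \<epsilon> * (?b (inverse v) * ?b I)"
        using \<epsilon> by (auto simp: mult.assoc inv)
      finally show "?b I * F' z = F' z * ?b I"
        using \<epsilon> by (auto simp: F'_def mult.assoc)
    qed
    ultimately show "\<exists>f'\<in>one_slice_preserving \<Omega> I - zero_on \<Omega>. eq_on \<Omega> f (star \<Omega> f' (\<lambda>_. v))"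
      by blast
  next
    assume "\<exists>f'\<in>one_slice_preserving \<Omega> I - zero_on \<Omega>. eq_on \<Omega> f (star \<Omega> f' (\<lambda>_. v))"
    then obtain f' where f': "f' \<in> one_slice_preserving \<Omega> I" "eq_on \<Omega> f (star \<Omega> f' (\<lambda>_. v))"
      by blast
    then obtain F' where F': "is_stem \<Omega> f' F'"
      using slice_regular_imp_is_stem[OF ssd] by (auto simp: one_slice_preserving_def)
    have "\<forall>z\<in>slice_trace \<Omega>. F z = F' z * ?b v"
      using f'(2) is_stem_unique[OF ssd F is_stem_star[OF ssd F' is_stem_const[OF ssd]]] by simp
    moreover have "?b I * (F' z * ?b v) = of_int \<epsilon> * (F' z * ?b v * ?b M)"
      if "z \<in> slice_trace \<Omega>" for z
    proof -
      have "?b I * (F' z * ?b v) = F' z * (?b I * ?b v)"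
        using f'(1) that
        by (simp add: one_slice_preserving_iff_stem[OF ssd F' I] flip: mult.assoc)
      then show ?thesis using \<epsilon> by (auto simp: bv mult.assoc)
    qed
    ultimately show "intertwined (slice_trace \<Omega>) I M \<epsilon> F"
      by (simp add: intertwined_def)
  qed
qed

text \<open>The mirror image: in \<open>u^-1 H\<close> the unit \<open>M\<close> cancels on the
  left, so this factor too belongs to the slice of \<open>I\<close>, not of
  \<open>M\<close>.\<close>

lemma intertwined_left_factor:
  assumes H: "is_stem \<Omega> h H" and nz: "h \<notin> zero_on \<Omega>" and I: "I \<in> imag_units"
    and \<epsilon>: "\<epsilon> \<in> {1, -1}" and u: "u \<noteq> 0" "M * u = of_int \<epsilon> * (u * I)"
  shows "intertwined (slice_trace \<Omega>) M I \<epsilon> H \<longleftrightarrow>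
    (\<exists>h'\<in>one_slice_preserving \<Omega> I - zero_on \<Omega>. eq_on \<Omega> h (star \<Omega> (\<lambda>_. u) h'))"
proof -
  let ?b = biquat_of_quat
  have bu: "?b M * ?b u = of_int \<epsilon> * (?b u * ?b I)"
    using arg_cong[OF u(2), of ?b] \<epsilon>
    by (auto simp: biquat_of_quat_mult biquat_of_quat_uminus biquat_of_quat_1)
  have inv: "?b (inverse u) * ?b u = 1" "?b u * ?b (inverse u) = 1"
    using u(1) by (simp_all flip: biquat_of_quat_mult add: biquat_of_quat_1)
  show ?thesis
  proof
    assume tw: "intertwined (slice_trace \<Omega>) M I \<epsilon> H"
    define H' where "H' z = ?b (inverse u) * H z" for z
    have H': "is_stem \<Omega> (stem_function H') H'"
    proof (rule is_stem_stem_function[OF ssd])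
      show "biquat_holomorphic H' (slice_trace \<Omega>)"
        using H unfolding H'_def is_stem_def
        by (intro biquat_holomorphic_mult biquat_holomorphic_const) auto
    qed (use H in \<open>simp add: H'_def is_stem_def biquat_cnj_mult\<close>)
    have star: "is_stem \<Omega> (star \<Omega> (\<lambda>_. u) (stem_function H')) (\<lambda>z. ?b u * H' z)"
      by (intro is_stem_star[OF ssd] H' is_stem_const[OF ssd])
    have HH': "H z = ?b u * H' z" for z
      by (simp add: H'_def inv flip: mult.assoc)
    have "eq_on \<Omega> h (star \<Omega> (\<lambda>_. u) (stem_function H'))"
      unfolding is_stem_unique[OF ssd H star] by (simp add: HH')
    moreover have "stem_function H' \<notin> zero_on \<Omega>"
      using nz unfolding zero_on_iff_stem[OF ssd H'] zero_on_iff_stem[OF ssd H]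
      by (metis HH' mult_zero_right)
    moreover have "stem_function H' \<in> one_slice_preserving \<Omega> I"
      unfolding one_slice_preserving_iff_stem[OF ssd H' I]
    proof
      fix z assume "z \<in> slice_trace \<Omega>"
      then have Hz: "?b M * H z = of_int \<epsilon> * (H z * ?b I)"
        using tw by (simp add: intertwined_def)
      have "?b I * ?b (inverse u) = ?b (inverse u) * (?b u * ?b I) * ?b (inverse u)"
        by (simp add: inv flip: mult.assoc)
      also have "?b u * ?b I = of_int \<epsilon> * (?b M * ?b u)"
        using \<epsilon> by (auto simp: bu)
      also have "?b (inverse u) * (of_int \<epsilon> * (?b M * ?b u)) * ?b (inverse u) =
          of_int \<epsilon> * (?b (inverse u) * ?b M)"
        using \<epsilon> by (auto simp: mult.assoc inv)
      finally have "?b I * H' z = of_int \<epsilon> * (?b (inverse u) * (?b M * H z))"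
        by (simp add: H'_def flip: mult.assoc)
      then show "?b I * H' z = H' z * ?b I"
        using \<epsilon> by (auto simp: Hz H'_def mult.assoc)
    qed
    ultimately show "\<exists>h'\<in>one_slice_preserving \<Omega> I - zero_on \<Omega>. eq_on \<Omega> h (star \<Omega> (\<lambda>_. u) h')"
      by blast
  next
    assume "\<exists>h'\<in>one_slice_preserving \<Omega> I - zero_on \<Omega>. eq_on \<Omega> h (star \<Omega> (\<lambda>_. u) h')"
    then obtain h' where h': "h' \<in> one_slice_preserving \<Omega> I" "eq_on \<Omega> h (star \<Omega> (\<lambda>_. u) h')"
      by blast
    then obtain H' where H': "is_stem \<Omega> h' H'"
      using slice_regular_imp_is_stem[OF ssd] by (auto simp: one_slice_preserving_def)
    have "\<forall>z\<in>slice_trace \<Omega>. H z = ?b u * H' z"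
      using h'(2) is_stem_unique[OF ssd H is_stem_star[OF ssd is_stem_const[OF ssd] H']] by simp
    moreover have "?b M * (?b u * H' z) = of_int \<epsilon> * (?b u * H' z * ?b I)"
      if "z \<in> slice_trace \<Omega>" for z
    proof -
      have "?b M * (?b u * H' z) = of_int \<epsilon> * (?b u * (?b I * H' z))"
        by (simp add: bu flip: mult.assoc)
      also have "?b I * H' z = H' z * ?b I"
        using h'(1) that by (simp add: one_slice_preserving_iff_stem[OF ssd H' I])
      finally show ?thesis by (simp add: mult.assoc)
    qed
    ultimately show "intertwined (slice_trace \<Omega>) M I \<epsilon> H"
      by (simp add: intertwined_def)
  qed
qed

end


section \<open>Imaginary units\<close>

lemma imag_units_nonzero: "I \<in> imag_units \<Longrightarrow> I \<noteq> 0"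
  using norm_imag_units by fastforce

text \<open>For imaginary quaternions \<open>I K + K I\<close> is minus twice the inner
  product.\<close>

lemma orthogonal_imag_units_anticommute:
  assumes "I \<in> imag_units" "K \<in> imag_units" "orthogonal K I"
  shows "I * K = - (K * I)"
  using assms
  by (simp add: orthogonal_def inner_quat_def imag_units_iff quat_eq_iff times_quat_def
      uminus_quat_def algebra_simps)

text \<open>An imaginary unit in \<open>slice I\<close> has no real part, hence is a real multiple
  of \<open>I\<close> of norm 1.\<close>

lemma slice_eq_iff:
  assumes I: "I \<in> imag_units" and M: "M \<in> imag_units"
  shows "slice I = slice M \<longleftrightarrow> M = I \<or> M = - I"
proof
  assume "slice I = slice M"
  moreover have "M \<in> slice M" by (simp add: slice_def span_base)
  ultimately obtain z where "M = of_real (Re z) + Im z *\<^sub>R I"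
    by (auto simp: slice_eq_range slice_embed_def)
  then have M_eq: "M = Im z *\<^sub>R I"
    using I M by (simp add: imag_units_iff quat_eq_iff quat_ops of_real_def)
  then have "\<bar>Im z\<bar> = 1"
    using norm_imag_units[OF I] norm_imag_units[OF M] by simp
  then show "M = I \<or> M = - I"
    using M_eq by (auto simp: abs_if split: if_splits)
next
  have "slice (- I) \<subseteq> slice I" for I
    unfolding slice_def by (intro span_minimal) (auto intro: span_base span_neg)
  from this[of I] this[of "- I"] have "slice (- I) = slice I" by simp
  then show "M = I \<or> M = - I \<Longrightarrow> slice I = slice M" by auto
qed

text \<open>A quarter turn of the projection of \<open>I\<close> to the plane of \<open>i\<close>
  and \<open>j\<close>, normalised; if the projection vanishes, \<open>i\<close> itself is
  orthogonal to \<open>I\<close>.\<close>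

lemma orthogonal_imag_unit_exists:
  assumes "I \<in> imag_units"
  obtains K where "K \<in> imag_units" "orthogonal K I"
proof (cases "qIm1 I = 0 \<and> qIm2 I = 0")
  case True
  then have "orthogonal quat_i I"
    by (simp add: orthogonal_def inner_quat_def quat_i_def)
  then show ?thesis using that quat_units(1) by blast
next
  case False
  define n where "n = sqrt ((qIm1 I)\<^sup>2 + (qIm2 I)\<^sup>2)"
  have n: "n\<^sup>2 = (qIm1 I)\<^sup>2 + (qIm2 I)\<^sup>2" by (simp add: n_def)
  have "n \<noteq> 0" using False by (auto simp: n_def add_nonneg_eq_0_iff)
  let ?K = "Quat 0 (- qIm2 I / n) (qIm1 I / n) 0"
  have "?K \<in> imag_units"
    using False \<open>n \<noteq> 0\<close> n by (simp add: imag_units_iff power_divide add.commute flip: add_divide_distrib)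
  moreover have "orthogonal ?K I"
    by (simp add: orthogonal_def inner_quat_def)
  ultimately show ?thesis by (rule that)
qed

lemma wedge_eq:
  "wedge p q = Quat 0 (qIm2 p * qIm3 q - qIm3 p * qIm2 q) (qIm3 p * qIm1 q - qIm1 p * qIm3 q)
     (qIm1 p * qIm2 q - qIm2 p * qIm1 q)"
  by (simp add: wedge_def quat_of_vec_def im_vec_def cross3_def)

text \<open>The orthonormal frame \<open>I, J = K I, K\<close> with \<open>M = a I + b J\<close>; here \<open>a = \<langle>I, M\<rangle>\<close> and \<open>b = |I \<and> M|\<close>.\<close>

lemma wedge_frame:
  assumes I: "I \<in> imag_units" and M: "M \<in> imag_units" and ne: "slice I \<noteq> slice M"
  defines "K \<equiv> wedge I M /\<^sub>R norm (wedge I M)"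
  shows "K \<in> imag_units" "orthogonal K I" "norm (wedge I M) > 0"
    "(I \<bullet> M)\<^sup>2 + (norm (wedge I M))\<^sup>2 = 1"
    "M = (I \<bullet> M) *\<^sub>R I + norm (wedge I M) *\<^sub>R (K * I)"
proof -
  let ?W = "wedge I M"
  have unit: "qRe I = 0" "qIm1 I * qIm1 I + qIm2 I * qIm2 I + qIm3 I * qIm3 I = 1"
    "qRe M = 0" "qIm1 M * qIm1 M + qIm2 M * qIm2 M + qIm3 M * qIm3 M = 1"
    using I M by (simp_all add: imag_units_iff power2_eq_square)
  \<comment> \<open>Lagrange's identity for the cross product.\<close>
  have "(I \<bullet> M)\<^sup>2 + ?W \<bullet> ?W = (qIm1 I * qIm1 I + qIm2 I * qIm2 I + qIm3 I * qIm3 I) *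
      (qIm1 M * qIm1 M + qIm2 M * qIm2 M + qIm3 M * qIm3 M)"
    using unit(1,3) by (simp add: inner_quat_def wedge_eq power2_eq_square algebra_simps)
  then show sum: "(I \<bullet> M)\<^sup>2 + (norm ?W)\<^sup>2 = 1"
    using unit by (simp add: power2_norm_eq_inner)
  have WI: "?W * I = M - (I \<bullet> M) *\<^sub>R I"
  proof -
    \<comment> \<open>Inserting the squared norm of \<open>I\<close>, which is 1, makes the triple
      product identity polynomial in the coordinates.\<close>
    have "qIm1 M = (qIm1 I * qIm1 I + qIm2 I * qIm2 I + qIm3 I * qIm3 I) * qIm1 M"
      "qIm2 M = (qIm1 I * qIm1 I + qIm2 I * qIm2 I + qIm3 I * qIm3 I) * qIm2 M"
      "qIm3 M = (qIm1 I * qIm1 I + qIm2 I * qIm2 I + qIm3 I * qIm3 I) * qIm3 M"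
      using unit(2) by simp_all
    then show ?thesis
      using unit(1,3)
      by (simp add: quat_eq_iff inner_quat_def wedge_eq quat_ops algebra_simps)
  qed
  have "?W \<noteq> 0"
  proof
    assume W: "?W = 0"
    then have "I \<bullet> M = 1 \<or> I \<bullet> M = -1"
      using sum by (simp add: power2_eq_1_iff)
    moreover have "M = (I \<bullet> M) *\<^sub>R I"
      using WI W by simp
    ultimately have "M = I \<or> M = - I"
      by (metis scaleR_minus1_left scaleR_one)
    then show False
      using ne by (simp add: slice_eq_iff[OF I M])
  qed
  then show pos: "norm ?W > 0" by simp
  then have "norm ?W *\<^sub>R (K * I) = ?W * I"
    by (simp add: K_def)
  then show "M = (I \<bullet> M) *\<^sub>R I + norm ?W *\<^sub>R (K * I)"
    by (simp add: WI)
  show "orthogonal K I"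
    by (simp add: K_def orthogonal_def inner_quat_def wedge_eq scaleR_quat_def algebra_simps)
  have "norm K = 1"
    using pos by (simp add: K_def)
  moreover have "qRe K = 0"
    by (simp add: K_def scaleR_quat_def wedge_eq[of I M])
  ultimately show "K \<in> imag_units"
    by (simp add: imag_units_iff norm_quat_eq)
qed

text \<open>With \<open>a = cos t\<close> and \<open>b = sin t\<close>, the number \<open>c\<close>
  is \<open>- tan (t/2)\<close> or \<open>cot (t/2)\<close>. So \<open>1 + c K\<close> is a multiple
  of a half-angle rotation about \<open>K\<close> whose conjugation carries \<open>M\<close> to
  \<open>\<epsilon> I\<close>, and \<open>1 - c K\<close> is a multiple of its inverse.\<close>

lemma half_angle_intertwines:
  assumes I: "I \<in> imag_units" and K: "K \<in> imag_units" and orth: "orthogonal K I"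
    and b: "b > 0" and ab: "a\<^sup>2 + b\<^sup>2 = 1" and M: "M = a *\<^sub>R I + b *\<^sub>R (K * I)"
    and \<epsilon>: "\<epsilon> \<in> {1, -1}" and c: "c = (a - of_int \<epsilon>) / b"
  shows "I * (1 + c *\<^sub>R K) = of_int \<epsilon> * ((1 + c *\<^sub>R K) * M)"
    and "M * (1 - c *\<^sub>R K) = of_int \<epsilon> * ((1 - c *\<^sub>R K) * I)"
    and "1 + c *\<^sub>R K \<noteq> 0" and "1 - c *\<^sub>R K \<noteq> 0"
proof -
  define J where "J = K * I"
  have IK: "I * K = - J"
    using orthogonal_imag_units_anticommute[OF I K orth] by (simp add: J_def)
  have KJ: "K * J = - I"
    by (simp add: J_def imag_units_mult_self[OF K] flip: mult.assoc)
  have JK: "J * K = I"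
    using KJ by (simp add: J_def mult.assoc IK)
  have cb: "c * b = a - of_int \<epsilon>"
    using b by (simp add: c)
  \<comment> \<open>Multiplied by \<open>b\<close>, the difference of the two sides is
    \<open>a^2 + b^2 - \<epsilon>^2 = 0\<close>.\<close>
  have ac: "b + c * a = - (of_int \<epsilon> * c)"
  proof -
    have "(b + c * a + of_int \<epsilon> * c) * b = b\<^sup>2 + (c * b) * a + of_int \<epsilon> * (c * b)"
      by (simp add: power2_eq_square algebra_simps)
    also have "\<dots> = 0"
      unfolding cb using ab \<epsilon> by (auto simp: power2_eq_square algebra_simps)
    finally show ?thesis using b by simp
  qed
  have "(1 + c *\<^sub>R K) * M = (a - c * b) *\<^sub>R I + (b + c * a) *\<^sub>R J"
    by (simp add: M KJ algebra_simps flip: J_def)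
  then have "(1 + c *\<^sub>R K) * M = of_int \<epsilon> *\<^sub>R I - (of_int \<epsilon> * c) *\<^sub>R J"
    by (simp add: cb ac)
  then show "I * (1 + c *\<^sub>R K) = of_int \<epsilon> * ((1 + c *\<^sub>R K) * M)"
    using \<epsilon> by (auto simp: distrib_left IK)
  have "M * (1 - c *\<^sub>R K) = (a - c * b) *\<^sub>R I + (b + c * a) *\<^sub>R J"
    by (simp add: M JK IK algebra_simps flip: J_def)
  then have "M * (1 - c *\<^sub>R K) = of_int \<epsilon> *\<^sub>R I - (of_int \<epsilon> * c) *\<^sub>R J"
    by (simp add: cb ac)
  then show "M * (1 - c *\<^sub>R K) = of_int \<epsilon> * ((1 - c *\<^sub>R K) * I)"
    using \<epsilon> by (auto simp: left_diff_distrib J_def)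
  have "qRe (1 + c *\<^sub>R K) = 1" "qRe (1 - c *\<^sub>R K) = 1"
    using K by (simp_all add: imag_units_iff quat_ops)
  then show "1 + c *\<^sub>R K \<noteq> 0" "1 - c *\<^sub>R K \<noteq> 0"
    by (auto simp: zero_quat_def)
qed


section \<open>Factorisation of mutually one-slice-preserving products\<close>

text \<open>A factorisation alone allows slice preserving products, for instance
  \<open>f = h = 1\<close> when the slices agree. The equivalence therefore states this exclusion
  beside the factorisation, and the last conjunct records what a factorisation yields by
  itself.\<close>

theorem theorem6p1:
  fixes \<Omega> :: "quat set" and f h :: "quat \<Rightarrow> quat" and I0 M0 :: quat
  assumes "symmetric_slice_domain \<Omega>"
    and "f \<in> slice_regular \<Omega> - zero_on \<Omega>"
    and "h \<in> slice_regular \<Omega> - zero_on \<Omega>"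
    and "I0 \<in> imag_units" and "M0 \<in> imag_units"
  shows
    "let factored =
       (slice I0 = slice M0 \<longrightarrow>
          (f \<in> one_slice_preserving \<Omega> I0 \<and> h \<in> one_slice_preserving \<Omega> I0) \<or>
          (\<exists>J0\<in>imag_units. \<exists>K0\<in>imag_units. orthogonal J0 I0 \<and> orthogonal K0 I0 \<and>
             (\<exists>f'\<in>one_slice_preserving \<Omega> I0 - zero_on \<Omega>.
              \<exists>h'\<in>one_slice_preserving \<Omega> I0 - zero_on \<Omega>.
                eq_on \<Omega> f (star \<Omega> f' (\<lambda>_. K0)) \<and> eq_on \<Omega> h (star \<Omega> (\<lambda>_. J0) h')))) \<and>
       (slice I0 \<noteq> slice M0 \<longrightarrow>
          (let K0 = wedge I0 M0 /\<^sub>R norm (wedge I0 M0); J0 = K0 * I0 in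
           \<exists>a b :: real. b > 0 \<and> a\<^sup>2 + b\<^sup>2 = 1 \<and> M0 = a *\<^sub>R I0 + b *\<^sub>R J0 \<and>
             (\<exists>\<sigma>\<in>{1, -1}.
              \<exists>f'\<in>one_slice_preserving \<Omega> I0 - zero_on \<Omega>.
              \<exists>h'\<in>one_slice_preserving \<Omega> I0 - zero_on \<Omega>.
                eq_on \<Omega> f (star \<Omega> f' (\<lambda>_. 1 + ((a + \<sigma>) / b) *\<^sub>R K0)) \<and>
                eq_on \<Omega> h (star \<Omega> (\<lambda>_. 1 - ((a + \<sigma>) / b) *\<^sub>R K0) h'))))
     in
       (star \<Omega> f h \<in> one_slice_preserving \<Omega> I0 - slice_preserving \<Omega> \<and>
        star \<Omega> h f \<in> one_slice_preserving \<Omega> M0 - slice_preserving \<Omega>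
          \<longleftrightarrow> factored \<and> star \<Omega> f h \<notin> slice_preserving \<Omega>) \<and>
       (factored \<longrightarrow>
        star \<Omega> f h \<in> one_slice_preserving \<Omega> I0 \<and> star \<Omega> h f \<in> one_slice_preserving \<Omega> M0)"
proof -
  note ssd = assms(1) and I = assms(4) and M = assms(5)
  have nz: "f \<notin> zero_on \<Omega>" "h \<notin> zero_on \<Omega>"
    using assms by auto
  let ?D = "slice_trace \<Omega>"
  let ?S = "one_slice_preserving \<Omega> I0 - zero_on \<Omega>"
  obtain F where F: "is_stem \<Omega> f F"
    using slice_regular_imp_is_stem[OF ssd] assms(2) by blast
  obtain H where H: "is_stem \<Omega> h H"
    using slice_regular_imp_is_stem[OF ssd] assms(3) by blast
  define tw where "tw \<epsilon> \<longleftrightarrow> intertwined ?D I0 M0 \<epsilon> F \<and> intertwined ?D M0 I0 \<epsilon> H" for \<epsilon>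
  \<comment> \<open>Any fixed pair of nonzero constant solutions \<open>v\<close>, \<open>u\<close>
    may serve as the constant factors.\<close>
  have tw_iff: "tw \<epsilon> \<longleftrightarrow> (\<exists>f'\<in>?S. \<exists>h'\<in>?S.
      eq_on \<Omega> f (star \<Omega> f' (\<lambda>_. v)) \<and> eq_on \<Omega> h (star \<Omega> (\<lambda>_. u) h'))"
    if "\<epsilon> \<in> {1, -1}" "v \<noteq> 0" "I0 * v = of_int \<epsilon> * (v * M0)" "u \<noteq> 0" "M0 * u = of_int \<epsilon> * (u * I0)"
    for \<epsilon> u v
    unfolding tw_def intertwined_right_factor[OF ssd F nz(1) I that(1-3)]
      intertwined_left_factor[OF ssd H nz(2) I that(1,4,5)] by blast
  define A where "A \<longleftrightarrow> (f \<in> one_slice_preserving \<Omega> I0 \<and> h \<in> one_slice_preserving \<Omega> I0) \<or>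
    (\<exists>J0\<in>imag_units. \<exists>K0\<in>imag_units. orthogonal J0 I0 \<and> orthogonal K0 I0 \<and>
       (\<exists>f'\<in>?S. \<exists>h'\<in>?S.
          eq_on \<Omega> f (star \<Omega> f' (\<lambda>_. K0)) \<and> eq_on \<Omega> h (star \<Omega> (\<lambda>_. J0) h')))"
  define B where "B \<longleftrightarrow> (let K0 = wedge I0 M0 /\<^sub>R norm (wedge I0 M0); J0 = K0 * I0 in
    \<exists>a b :: real. b > 0 \<and> a\<^sup>2 + b\<^sup>2 = 1 \<and> M0 = a *\<^sub>R I0 + b *\<^sub>R J0 \<and>
      (\<exists>\<sigma>\<in>{1, -1}. \<exists>f'\<in>?S. \<exists>h'\<in>?S.
         eq_on \<Omega> f (star \<Omega> f' (\<lambda>_. 1 + ((a + \<sigma>) / b) *\<^sub>R K0)) \<and>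
         eq_on \<Omega> h (star \<Omega> (\<lambda>_. 1 - ((a + \<sigma>) / b) *\<^sub>R K0) h')))"
  define factored where "factored \<longleftrightarrow>
    (slice I0 = slice M0 \<longrightarrow> A) \<and> (slice I0 \<noteq> slice M0 \<longrightarrow> B)"
  have A_iff: "A \<longleftrightarrow> tw 1 \<or> tw (-1)" if eq: "slice I0 = slice M0"
  proof -
    obtain \<delta> :: int where \<delta>: "\<delta> \<in> {1, -1}" and M0: "M0 = of_int \<delta> * I0"
      using eq that unfolding slice_eq_iff[OF I M] by (auto intro: that[of 1] that[of "-1"])
    \<comment> \<open>For the sign \<open>\<delta>\<close> the two signs cancel and the relations
      say that both stems commute with \<open>I0\<close>.\<close>
    have "f \<in> one_slice_preserving \<Omega> I0 \<and> h \<in> one_slice_preserving \<Omega> I0 \<longleftrightarrow> tw \<delta>"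
      using \<delta> unfolding tw_def intertwined_def
        one_slice_preserving_iff_stem[OF ssd F I] one_slice_preserving_iff_stem[OF ssd H I]
      by (auto simp: M0 biquat_of_quat_uminus)
    \<comment> \<open>For the opposite sign the relations are anticommutation with
      \<open>I0\<close>, and all orthogonal units are constant solutions.\<close>
    moreover have "(\<exists>f'\<in>?S. \<exists>h'\<in>?S.
        eq_on \<Omega> f (star \<Omega> f' (\<lambda>_. K)) \<and> eq_on \<Omega> h (star \<Omega> (\<lambda>_. J) h')) \<longleftrightarrow> tw (- \<delta>)"
      if "J \<in> imag_units" "K \<in> imag_units" "orthogonal J I0" "orthogonal K I0" for J K
    proof (rule tw_iff[symmetric])
      show "- \<delta> \<in> {1, -1}" using \<delta> by auto
      show "K \<noteq> 0" "J \<noteq> 0" using that by (simp_all add: imag_units_nonzero)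
      have "I0 * K = - (K * I0)" "I0 * J = - (J * I0)"
        using that by (simp_all add: orthogonal_imag_units_anticommute I)
      then show "I0 * K = of_int (- \<delta>) * (K * M0)" "M0 * J = of_int (- \<delta>) * (J * I0)"
        using \<delta> by (auto simp: M0)
    qed
    \<comment> \<open>Witnesses for \<open>J0\<close> and \<open>K0\<close> in passing from
      \<open>tw (- \<delta>)\<close> to \<open>A\<close>.\<close>
    moreover obtain K where "K \<in> imag_units" "orthogonal K I0"
      by (rule orthogonal_imag_unit_exists[OF I])
    ultimately have "A \<longleftrightarrow> tw \<delta> \<or> tw (- \<delta>)"
      unfolding A_def by blast
    then show ?thesis using \<delta> by auto
  qed
  have B_iff: "B \<longleftrightarrow> tw 1 \<or> tw (-1)" if ne: "slice I0 \<noteq> slice M0"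
  proof -
    let ?K = "wedge I0 M0 /\<^sub>R norm (wedge I0 M0)"
    note frame = wedge_frame[OF I M ne]
    \<comment> \<open>the sign \<open>\<sigma>\<close> of the statement is \<open>- \<epsilon>\<close>\<close>
    have branch: "(\<exists>f'\<in>?S. \<exists>h'\<in>?S.
        eq_on \<Omega> f (star \<Omega> f' (\<lambda>_. 1 + ((a - of_int \<epsilon>) / b) *\<^sub>R ?K)) \<and>
        eq_on \<Omega> h (star \<Omega> (\<lambda>_. 1 - ((a - of_int \<epsilon>) / b) *\<^sub>R ?K) h')) \<longleftrightarrow> tw \<epsilon>"
      if "b > 0" "a\<^sup>2 + b\<^sup>2 = 1" "M0 = a *\<^sub>R I0 + b *\<^sub>R (?K * I0)" "\<epsilon> \<in> {1, -1}" for a b \<epsilon>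
      using half_angle_intertwines[OF I frame(1,2) that refl] that(4)
      by (intro tw_iff[symmetric])
    \<comment> \<open>The disjunction in \<open>tw\<close> does not involve \<open>a\<close> and
      \<open>b\<close>, so only the existence of such numbers remains, and the frame supplies
      it.\<close>
    have "B \<longleftrightarrow> (\<exists>a b :: real. b > 0 \<and> a\<^sup>2 + b\<^sup>2 = 1 \<and> M0 = a *\<^sub>R I0 + b *\<^sub>R (?K * I0) \<and>
        (tw 1 \<or> tw (-1)))"
      unfolding B_def Let_def
    proof (intro ex_cong1 conj_cong refl)
      fix a b :: real
      assume "b > 0" "a\<^sup>2 + b\<^sup>2 = 1" "M0 = a *\<^sub>R I0 + b *\<^sub>R (?K * I0)"
      from branch[OF this, of 1] branch[OF this, of "-1"]
      show "(\<exists>\<sigma>\<in>{1, -1}. \<exists>f'\<in>?S. \<exists>h'\<in>?S.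
         eq_on \<Omega> f (star \<Omega> f' (\<lambda>_. 1 + ((a + \<sigma>) / b) *\<^sub>R ?K)) \<and>
         eq_on \<Omega> h (star \<Omega> (\<lambda>_. 1 - ((a + \<sigma>) / b) *\<^sub>R ?K) h')) \<longleftrightarrow> tw 1 \<or> tw (-1)"
        by auto
    qed
    then show ?thesis using frame(3-5) by blast
  qed
  have factored_iff: "factored \<longleftrightarrow> tw 1 \<or> tw (-1)"
    using A_iff B_iff by (auto simp: factored_def)
  have imp: "star \<Omega> f h \<in> one_slice_preserving \<Omega> I0 \<and> star \<Omega> h f \<in> one_slice_preserving \<Omega> M0"
    if "factored"
  proof -
    obtain \<epsilon> where "\<epsilon> \<in> {1, -1}" "tw \<epsilon>"
      using \<open>factored\<close> unfolding factored_iff by blast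
    then show ?thesis
      using intertwined_imp_one_slice_preserving[OF ssd F H I]
        intertwined_imp_one_slice_preserving[OF ssd H F M] unfolding tw_def by blast
  qed
  have conv: "factored" if star: "star \<Omega> f h \<in> one_slice_preserving \<Omega> I0"
    "star \<Omega> h f \<in> one_slice_preserving \<Omega> M0" "star \<Omega> f h \<notin> slice_preserving \<Omega>"
  proof -
    obtain \<epsilon> where "\<epsilon> \<in> {1, -1}" "tw \<epsilon>"
      using one_slice_preserving_imp_intertwined[OF ssd F H I M star] unfolding tw_def by blast
    then show ?thesis unfolding factored_iff by blast
  qed
  \<comment> \<open>Excluding slice preservation for \<open>f * h\<close> excludes it for
    \<open>h * f\<close>, by the contrapositive of
    \<open>star_slice_preserving_commute\<close>.\<close>
  have "(star \<Omega> f h \<in> one_slice_preserving \<Omega> I0 - slice_preserving \<Omega> \<and>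
      star \<Omega> h f \<in> one_slice_preserving \<Omega> M0 - slice_preserving \<Omega>
        \<longleftrightarrow> factored \<and> star \<Omega> f h \<notin> slice_preserving \<Omega>) \<and>
     (factored \<longrightarrow>
        star \<Omega> f h \<in> one_slice_preserving \<Omega> I0 \<and> star \<Omega> h f \<in> one_slice_preserving \<Omega> M0)"
    using imp conv star_slice_preserving_commute[OF ssd F H I M] by blast
  then show ?thesis
    unfolding factored_def A_def B_def Let_def .
qed

end
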